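(* For all $m,n\in\mathbb{N}=\{0,1,2,\dots\}$, $H_{m,n}(z)$ is a polynomial of degree $m\times n$. Moreover, $H_{m,n}(z)$ has exactly $m$ real roots when $n$ is odd, and none when $n$ is even.
   Context: Generalised Hermite polynomials $H_{m,n}(z)$, $m,n\in\mathbb{N}$, are defined recursively by $$2mH_{m+1,n}H_{m-1,n}=H_{m,n}H_{m,n}''-(H_{m,n}')^2+2mH_{m,n}^2,$$ $$2nH_{m,n+1}H_{m,n-1}=-H_{m,n}H_{m,n}''+(H_{m,n}')^2+2nH_{m,n}^2,$$ with $H_{0,0}=H_{1,0}=H_{0,1}=1$ and $H_{1,1}=2z$. *)

theory Defs
  imports "HOL-Computational_Algebra.Computational_Algebra" Complex_Main
begin

lemma fract_quotient_rule_cong: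
  fixes a b c d :: "'a::idom poly"
  assumes b: "b \<noteq> 0" and d: "d \<noteq> 0"
    and eq_Fract: "Fraction_Field.Fract a b = Fraction_Field.Fract c d"
  shows "Fraction_Field.Fract (pderiv a * b - a * pderiv b) (b\<^sup>2) =
    Fraction_Field.Fract (pderiv c * d - c * pderiv d) (d\<^sup>2)"
proof -
  have eq: "a * d = c * b"
    using b d eq_Fract by (simp add: eq_fract)
  have deriv_eq: "pderiv a * d + a * pderiv d = pderiv c * b + c * pderiv b"
    using arg_cong[OF eq, of pderiv] by (simp add: pderiv_mult algebra_simps)
  have "(pderiv a * b - a * pderiv b) * d\<^sup>2 - (pderiv c * d - c * pderiv d) * b\<^sup>2
      = b * d * ((pderiv a * d + a * pderiv d) - (pderiv c * b + c * pderiv b))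
        - (a * d - c * b) * (b * pderiv d + d * pderiv b)"
    by (simp add: algebra_simps power2_eq_square)
  also have "\<dots> = 0"
    by (simp add: deriv_eq eq)
  finally show ?thesis
    using b d by (simp add: eq_fract)
qed

text \<open>
  Formal differentiation of rational functions by the quotient rule, which does not depend
  on the fraction chosen.
\<close>

definition fract_deriv :: "'a::idom poly fract \<Rightarrow> 'a poly fract" where
  "fract_deriv r = (THE s. \<exists>p q. q \<noteq> 0 \<and> r = Fraction_Field.Fract p q \<and>
     s = Fraction_Field.Fract (pderiv p * q - p * pderiv q) (q\<^sup>2))"

lemma fract_deriv_Fract:
  assumes "q \<noteq> 0"
  shows "fract_deriv (Fraction_Field.Fract p q) =
    Fraction_Field.Fract (pderiv p * q - p * pderiv q) (q\<^sup>2)"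
  unfolding fract_deriv_def
proof (rule the_equality)
  show "\<exists>p' q'. q' \<noteq> 0 \<and> Fraction_Field.Fract p q = Fraction_Field.Fract p' q' \<and>
      Fraction_Field.Fract (pderiv p * q - p * pderiv q) (q\<^sup>2) =
      Fraction_Field.Fract (pderiv p' * q' - p' * pderiv q') (q'\<^sup>2)"
    by (intro exI[of _ p] exI[of _ q] conjI assms refl)
next
  fix s
  assume "\<exists>p' q'. q' \<noteq> 0 \<and> Fraction_Field.Fract p q = Fraction_Field.Fract p' q' \<and>
      s = Fraction_Field.Fract (pderiv p' * q' - p' * pderiv q') (q'\<^sup>2)"
  then obtain p' q' where "q' \<noteq> 0" "Fraction_Field.Fract p q = Fraction_Field.Fract p' q'"
    and s: "s = Fraction_Field.Fract (pderiv p' * q' - p' * pderiv q') (q'\<^sup>2)"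
    by (elim exE conjE)
  then show "s = Fraction_Field.Fract (pderiv p * q - p * pderiv q) (q\<^sup>2)"
    unfolding s using fract_quotient_rule_cong[OF assms, of q' p p'] by metis
qed

lemma fract_deriv_to_fract: "fract_deriv (to_fract p) = to_fract (pderiv p)"
  by (simp add: to_fract_def fract_deriv_Fract)

text \<open>
  The recurrences involve a division, so a priori they only determine rational functions of
  the complex variable z; that these are polynomials is not built into the type. Each
  recurrence is imposed at the indices where all of its terms are defined; at the omitted
  boundary indices (m = 0, resp. n = 0) the term with index -1 carries a factor 0.
\<close>

definition gen_hermite_family :: "(nat \<Rightarrow> nat \<Rightarrow> complex poly fract) \<Rightarrow> bool" where
  "gen_hermite_family H \<longleftrightarrow>
     (\<forall>m n. m \<ge> 1 \<longrightarrow>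
        2 * of_nat m * H (m + 1) n * H (m - 1) n =
          H m n * fract_deriv (fract_deriv (H m n)) - (fract_deriv (H m n))\<^sup>2
            + 2 * of_nat m * (H m n)\<^sup>2) \<and>
     (\<forall>m n. n \<ge> 1 \<longrightarrow>
        2 * of_nat n * H m (n + 1) * H m (n - 1) =
          - (H m n * fract_deriv (fract_deriv (H m n))) + (fract_deriv (H m n))\<^sup>2
            + 2 * of_nat n * (H m n)\<^sup>2) \<and>
     H 0 0 = 1 \<and> H 1 0 = 1 \<and> H 0 1 = 1 \<and> H 1 1 = to_fract [:0, 2:]"

text \<open>
  The conditions above overdetermine the family, and its existence and uniqueness are not
  proved here: they are needed to derive anything specific about the constant defined next.
\<close>

definition gen_hermite :: "nat \<Rightarrow> nat \<Rightarrow> complex poly fract" where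
  "gen_hermite = (THE H. gen_hermite_family H)"

end

theory Submission
  imports Defs "Jordan_Normal_Form.Char_Poly"
begin

text \<open>
  The generalised Hermite polynomials are, up to explicit constants, determinants of the derivatives
  of the Gaussian. With p_k exp(-z^2) the k-th derivative of exp(-z^2), let D(m,n) be the Hankel
  determinant of order n with entries p_(m+i+j). The same determinant is the Wronskian of p_m, ...,
  p_(m+n-1), and since the derivative of p_k is a multiple of p_(k-1), differentiation acts on it like
  a shift of indices. Applying the Desnanot-Jacobi identity to these two forms and to different
  choices of the deleted rows and columns (\<open>hankel_toda\<close>, \<open>hankel_two_direction\<close>,
  \<open>hankel_dodgson\<close>, \<open>hankel_wronskian_pair\<close>) yields four bilinear identities. The
  first is the recurrence for n, and its difference with the second is the recurrence for m. So the
  normalised determinants H(m,n) form a family as required, and as none of them is zero, the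
  recurrences leave no other choice (\<open>gen_hermite_family_unique\<close>). The degree and the
  leading coefficient 2^(mn) can be read off the recurrence for n.

  The real zeros come from two further consequences of the identities, for n at least 1:

    H(m,n+1) H(m,n-1) = H(m,n)^2 + 2m H(m-1,n+1) H(m+1,n-1), where m is at least 1,

    H(m,n) H(m+1,n)' - H(m,n)' H(m+1,n) = 2n H(m+1,n-1) H(m,n+1).

  The first one shows by induction that H(m,n) is positive on the real line for even n. For odd n, the
  indices n - 1 and n + 1 are even, so the second one shows that the Wronskian of H(m,n) and
  H(m+1,n) is positive on the real line. As in Sturm theory, the real zeros of these two polynomials then
  separate each other, and comparing signs at plus and minus infinity shows that H(m+1,n) has
  exactly one real zero more than H(m,n). As H(0,n) = 1, there are m of them.
\<close>

(* Leaves the name smult to the scalar multiplication of polynomials. *)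
hide_const (open) Module.smult

section \<open>Determinants and the Desnanot-Jacobi identity\<close>

text \<open>
  Determinants of matrices given by an entry function, so that Hankel matrices, Wronskians and
  their minors, for every size and every choice of deleted lines, are instances of one constant.
\<close>

definition fdet :: "nat \<Rightarrow> (nat \<Rightarrow> nat \<Rightarrow> 'a::comm_ring_1) \<Rightarrow> 'a" where
  "fdet n f = det (mat n n (\<lambda>(i, j). f i j))"

lemma fdet_cong:
  assumes "\<And>i j. i < n \<Longrightarrow> j < n \<Longrightarrow> f i j = g i j"
  shows "fdet n f = fdet n g"
  unfolding fdet_def by (rule arg_cong[where f = det], rule eq_matI) (auto simp: assms)

lemma fdet_0 [simp]: "fdet 0 f = 1"
  by (simp add: fdet_def)

lemma fdet_1: "fdet (Suc 0) f = f 0 0"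
  by (simp add: fdet_def det_single)

lemma fdet_transpose: "fdet n (\<lambda>i j. f j i) = fdet n f"
proof -
  have "mat n n (\<lambda>(i, j). f j i) = transpose_mat (mat n n (\<lambda>(i, j). f i j))"
    by (rule eq_matI) auto
  then show ?thesis
    unfolding fdet_def by (simp add: det_transpose[of _ n])
qed

lemma fdet_scale_rows: "fdet n (\<lambda>i j. c i * f i j) = (\<Prod>i<n. c i) * fdet n f"
  unfolding fdet_def
  by (subst (1 2) det_def'[of _ n])
     (auto simp: sum_distrib_left prod.distrib atLeast0LessThan algebra_simps
       intro!: sum.cong prod.cong)

lemma fdet_scale_columns: "fdet n (\<lambda>i j. c j * f i j) = (\<Prod>j<n. c j) * fdet n f"
  using fdet_scale_rows[of n c "\<lambda>i j. f j i"]
  by (simp only: fdet_transpose[of n "\<lambda>i j. c j * f i j"] fdet_transpose[of n f])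

lemma fdet_equal_columns:
  assumes "p \<noteq> q" "p < n" "q < n" "\<And>i. i < n \<Longrightarrow> f i p = f i q"
  shows "fdet n f = 0"
  unfolding fdet_def using assms
  by (intro det_identical_columns[of _ n p q]) auto

lemma fdet_equal_rows:
  assumes "p \<noteq> q" "p < n" "q < n" "\<And>j. j < n \<Longrightarrow> f p j = f q j"
  shows "fdet n f = 0"
  using fdet_equal_columns[of p q n "\<lambda>i j. f j i", OF assms] by (simp only: fdet_transpose[of n f])

definition minor :: "nat \<Rightarrow> (nat \<Rightarrow> nat \<Rightarrow> 'a) \<Rightarrow> nat \<Rightarrow> nat \<Rightarrow> 'a::comm_ring_1" where
  "minor n f r c = fdet n (\<lambda>i j. f (insert_index r i) (insert_index c j))"

definition set_column :: "nat \<Rightarrow> (nat \<Rightarrow> 'a) \<Rightarrow> (nat \<Rightarrow> nat \<Rightarrow> 'a) \<Rightarrow> nat \<Rightarrow> nat \<Rightarrow> 'a" where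
  "set_column q a f = (\<lambda>i j. if j = q then a i else f i j)"

lemma cofactor_mat_eq_minor:
  "cofactor (mat (Suc n) (Suc n) (\<lambda>(i, j). f i j)) r c = (-1) ^ (r + c) * minor n f r c"
proof -
  have "mat_delete (mat (Suc n) (Suc n) (\<lambda>(i, j). f i j)) r c
      = mat n n (\<lambda>(i, j). f (insert_index r i) (insert_index c j))"
    unfolding mat_delete_def by (rule eq_matI) (auto simp: insert_index_def)
  then show ?thesis
    by (simp add: cofactor_def minor_def fdet_def)
qed

lemma fdet_set_column_expand:
  assumes "q < Suc n"
  shows "fdet (Suc n) (set_column q a f)
    = (\<Sum>i<Suc n. a i * ((-1) ^ (i + q) * minor n f i q))"
proof -
  have *: "minor n (set_column q a f) i q = minor n f i q" for i
    unfolding minor_def set_column_def by (rule fdet_cong) auto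
  have "fdet (Suc n) (set_column q a f)
      = (\<Sum>i<Suc n. mat (Suc n) (Suc n) (\<lambda>(i, j). set_column q a f i j) $$ (i, q)
          * cofactor (mat (Suc n) (Suc n) (\<lambda>(i, j). set_column q a f i j)) i q)"
    unfolding fdet_def using assms by (intro laplace_expansion_column) auto
  also have "\<dots> = (\<Sum>i<Suc n. a i * ((-1) ^ (i + q) * minor n f i q))"
  proof (rule sum.cong[OF refl])
    fix i assume "i \<in> {..<Suc n}"
    then have "mat (Suc n) (Suc n) (\<lambda>(i, j). set_column q a f i j) $$ (i, q) = a i"
      using assms by (simp add: set_column_def)
    then show "mat (Suc n) (Suc n) (\<lambda>(i, j). set_column q a f i j) $$ (i, q)
          * cofactor (mat (Suc n) (Suc n) (\<lambda>(i, j). set_column q a f i j)) i q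
        = a i * ((-1) ^ (i + q) * minor n f i q)"
      by (simp only: cofactor_mat_eq_minor *)
  qed
  finally show ?thesis .
qed

lemma fdet_set_column_sum:
  assumes "q < n"
  shows "fdet n (set_column q (\<lambda>i. \<Sum>k\<in>S. x k * w k i) f)
    = (\<Sum>k\<in>S. x k * fdet n (set_column q (w k) f))"
proof -
  obtain n' where n: "n = Suc n'" using assms by (cases n) auto
  show ?thesis
    using assms unfolding n
    by (simp only: fdet_set_column_expand sum_distrib_left sum_distrib_right mult.assoc)
       (rule sum.swap)
qed

lemma fdet_set_column_unit:
  assumes "r < Suc n" "q < Suc n"
  shows "fdet (Suc n) (set_column q (\<lambda>i. if i = r then 1 else 0) f)
    = (-1) ^ (r + q) * minor n f r q"
proof -
  have "fdet (Suc n) (set_column q (\<lambda>i. if i = r then 1 else 0) f)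
      = (\<Sum>i<Suc n. if i = r then (-1) ^ (r + q) * minor n f r q else 0)"
    unfolding fdet_set_column_expand[OF assms(2)] by (rule sum.cong) auto
  then show ?thesis using assms(1) by (simp del: sum.lessThan_Suc)
qed

lemma fdet_swap_columns:
  assumes "p < n" "q < n" "p \<noteq> q"
  shows "fdet n (set_column p (\<lambda>i. f i q) (set_column q (\<lambda>i. f i p) f)) = - fdet n f"
proof -
  have "mat n n (\<lambda>(i, j). set_column p (\<lambda>i. f i q) (set_column q (\<lambda>i. f i p) f) i j)
      = swapcols p q (mat n n (\<lambda>(i, j). f i j))"
    using assms by (intro eq_matI) (auto simp: set_column_def)
  then show ?thesis
    using assms unfolding fdet_def by (simp add: det_swapcols[of _ n])
qed

text \<open>
  Expanding both new columns by linearity, every term repeats a column of the matrix except those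
  that put the columns p and q back into the positions p and q, in either order.
\<close>

lemma fdet_replace_two_columns_by_combinations:
  assumes p: "p < n" and q: "q < n" and pq: "p \<noteq> q"
  shows "fdet n (set_column p (\<lambda>i. \<Sum>k<n. x k * f i k)
            (set_column q (\<lambda>i. \<Sum>k<n. y k * f i k) f))
    = (x p * y q - x q * y p) * fdet n f"
proof -
  let ?b = "\<lambda>i. \<Sum>k<n. y k * f i k"
  define F where "F k = fdet n (set_column p (\<lambda>i. f i k) (set_column q ?b f))" for k
  have F_other: "F k = 0" if "k < n" "k \<noteq> p" "k \<noteq> q" for k
    unfolding F_def
    by (rule fdet_equal_columns[of p k]) (use that p in \<open>auto simp: set_column_def\<close>)
  have single: "fdet n (set_column q ?b f) = y q * fdet n f"
  proof -
    have "fdet n (set_column q ?b f) = (\<Sum>k<n. y k * fdet n (set_column q (\<lambda>i. f i k) f))"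
      by (rule fdet_set_column_sum[OF q])
    also have "\<dots> = (\<Sum>k<n. if k = q then y q * fdet n f else 0)"
    proof (rule sum.cong[OF refl])
      fix k assume k: "k \<in> {..<n}"
      have "fdet n (set_column q (\<lambda>i. f i k) f) = (if k = q then fdet n f else 0)"
      proof (cases "k = q")
        case True
        then show ?thesis by (auto simp: set_column_def intro: fdet_cong)
      next
        case False
        then show ?thesis
          using fdet_equal_columns[of q k n "set_column q (\<lambda>i. f i k) f"] k q
          by (auto simp: set_column_def)
      qed
      then show "y k * fdet n (set_column q (\<lambda>i. f i k) f) = (if k = q then y q * fdet n f else 0)"
        by auto
    qed
    finally show ?thesis using q by simp
  qed
  have Fp: "F p = y q * fdet n f"
    unfolding F_def single[symmetric] using pq by (intro fdet_cong) (auto simp: set_column_def)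
  have Fq: "F q = - (y p * fdet n f)"
  proof -
    have "F q = fdet n (set_column q ?b (set_column p (\<lambda>i. f i q) f))"
      unfolding F_def using pq by (intro fdet_cong) (auto simp: set_column_def)
    also have "\<dots> = (\<Sum>k<n. y k * fdet n (set_column q (\<lambda>i. f i k) (set_column p (\<lambda>i. f i q) f)))"
      by (rule fdet_set_column_sum[OF q])
    also have "\<dots> = (\<Sum>k<n. if k = p then - (y p * fdet n f) else 0)"
    proof (rule sum.cong[OF refl])
      fix k assume k: "k \<in> {..<n}"
      have "fdet n (set_column q (\<lambda>i. f i k) (set_column p (\<lambda>i. f i q) f))
          = (if k = p then - fdet n f else 0)"
      proof (cases "k = p")
        case True
        then show ?thesis
          using fdet_swap_columns[of q n p f] p q pq by simp
      next
        case k_p: False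
        show ?thesis
        proof (cases "k = q")
          case True
          then show ?thesis
            using fdet_equal_columns[of p q n
                "set_column q (\<lambda>i. f i k) (set_column p (\<lambda>i. f i q) f)"] k_p p q pq
            by (auto simp: set_column_def)
        next
          case False
          then show ?thesis
            using fdet_equal_columns[of q k n
                "set_column q (\<lambda>i. f i k) (set_column p (\<lambda>i. f i q) f)"] k_p k q
            by (auto simp: set_column_def)
        qed
      qed
      then show "y k * fdet n (set_column q (\<lambda>i. f i k) (set_column p (\<lambda>i. f i q) f))
          = (if k = p then - (y p * fdet n f) else 0)"
        by auto
    qed
    finally show ?thesis using p by simp
  qed
  have "fdet n (set_column p (\<lambda>i. \<Sum>k<n. x k * f i k) (set_column q ?b f))
      = (\<Sum>k<n. x k * F k)"
    unfolding F_def by (rule fdet_set_column_sum[OF p])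
  also have "\<dots> = (\<Sum>k\<in>{p, q}. x k * F k)"
    by (rule sum.mono_neutral_right) (use p q F_other in auto)
  also have "\<dots> = (x p * y q - x q * y p) * fdet n f"
    using pq by (simp add: Fp Fq algebra_simps)
  finally show ?thesis .
qed

text \<open>
  Cramer's rule without division: the numerators are the entries of the adjugate applied to the
  right-hand side, so they solve the linear system scaled by the determinant.
\<close>

lemma cramer_numerators_solve:
  assumes i: "i < n"
  shows "(\<Sum>k<n. fdet n (set_column k a f) * f i k) = fdet n f * a i"
proof -
  obtain n' where n: "n = Suc n'" using i by (cases n) auto
  let ?A = "mat n n (\<lambda>(i, j). f i j)"
  have adj: "(\<Sum>k<n. f i k * cofactor ?A r k) = (if r = i then fdet n f else 0)" if r: "r < n" for r
  proof -
    have "(?A * adj_mat ?A) $$ (i, r) = (det ?A \<cdot>\<^sub>m 1\<^sub>m n) $$ (i, r)"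
      by (subst adj_mat(2)[of ?A n]) auto
    then show ?thesis
      using i r by (simp add: adj_mat_def scalar_prod_def fdet_def atLeast0LessThan split: if_splits)
  qed
  have "(\<Sum>k<n. fdet n (set_column k a f) * f i k)
      = (\<Sum>k<n. (\<Sum>r<n. a r * cofactor ?A r k) * f i k)"
    unfolding n by (intro sum.cong refl) (simp add: fdet_set_column_expand cofactor_mat_eq_minor del: sum.lessThan_Suc)
  also have "\<dots> = (\<Sum>k<n. \<Sum>r<n. a r * (f i k * cofactor ?A r k))"
    by (intro sum.cong refl, subst sum_distrib_right) (simp add: mult_ac)
  also have "\<dots> = (\<Sum>r<n. a r * (\<Sum>k<n. f i k * cofactor ?A r k))"
    by (subst sum.swap) (simp add: sum_distrib_left)
  also have "\<dots> = (\<Sum>r<n. if r = i then fdet n f * a i else 0)"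
    by (intro sum.cong refl) (simp add: adj mult.commute)
  finally show ?thesis using i by simp
qed

text \<open>
  Replace the columns p and q by the multiples of a and b by the determinant d. By Cramer's rule
  these are combinations of the old columns, so the determinant obtained is d times a 2-by-2
  determinant of Cramer numerators; by homogeneity it is also d squared times the determinant with
  a and b inserted. One factor d cancels.
\<close>

lemma column_exchange_nonsingular:
  fixes f :: "nat \<Rightarrow> nat \<Rightarrow> 'a::idom"
  assumes p: "p < n" and q: "q < n" and pq: "p \<noteq> q" and nz: "fdet n f \<noteq> 0"
  shows "fdet n f * fdet n (set_column p a (set_column q b f))
    = fdet n (set_column p a f) * fdet n (set_column q b f)
      - fdet n (set_column q a f) * fdet n (set_column p b f)"
proof -
  let ?d = "fdet n f"
  let ?x = "\<lambda>k. fdet n (set_column k a f)" and ?y = "\<lambda>k. fdet n (set_column k b f)"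
  have scale: "fdet n (set_column r (\<lambda>i. ?d * c i) g) = ?d * fdet n (set_column r c g)"
    if "r < n" for r c g
    using fdet_set_column_sum[OF that, where S = "{0}" and x = "\<lambda>_. ?d" and w = "\<lambda>_. c" and f = g]
    by simp
  have swap: "set_column p u (set_column q v g) = set_column q v (set_column p u g)" for u v g
    using pq by (auto simp: set_column_def fun_eq_iff)
  have "(?x p * ?y q - ?x q * ?y p) * ?d
      = fdet n (set_column p (\<lambda>i. \<Sum>k<n. ?x k * f i k) (set_column q (\<lambda>i. \<Sum>k<n. ?y k * f i k) f))"
    by (rule fdet_replace_two_columns_by_combinations[OF p q pq, symmetric])
  also have "\<dots> = fdet n (set_column p (\<lambda>i. ?d * a i) (set_column q (\<lambda>i. ?d * b i) f))"
    by (rule fdet_cong)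
       (auto simp: set_column_def[of _ _ "set_column _ _ _"] set_column_def[of q _ f, THEN fun_cong, THEN fun_cong] cramer_numerators_solve)
  also have "\<dots> = ?d * (?d * fdet n (set_column p a (set_column q b f)))"
    by (subst scale[OF p], subst swap, subst scale[OF q]) (simp add: swap)
  finally show ?thesis using nz by (simp add: mult.commute)
qed

lemma poly_fdet: "poly (fdet n F) t = fdet n (\<lambda>i j. poly (F i j) t)"
  unfolding fdet_def by (rule poly_det_cong) auto

text \<open>
  The determinant of the matrix plus t times the identity is monic in t, being the characteristic
  polynomial of the negated matrix, hence nonzero. The identity therefore holds over the polynomials
  in t, and setting t to 0 gives it for singular matrices too.
\<close>

lemma column_exchange:
  fixes f :: "nat \<Rightarrow> nat \<Rightarrow> 'a::idom"
  assumes p: "p < n" and q: "q < n" and pq: "p \<noteq> q"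
  shows "fdet n f * fdet n (set_column p a (set_column q b f))
    = fdet n (set_column p a f) * fdet n (set_column q b f)
      - fdet n (set_column q a f) * fdet n (set_column p b f)"
proof -
  define F where "F i j = [:f i j, if i = j then 1 else 0:]" for i j
  have "fdet n F = char_poly (mat n n (\<lambda>(i, j). - f i j))"
    unfolding fdet_def char_poly_defs F_def
    by (rule arg_cong[where f = det], rule eq_matI) auto
  then have "fdet n F \<noteq> 0"
    using degree_monic_char_poly[of "mat n n (\<lambda>(i, j). - f i j)" n] by auto
  from column_exchange_nonsingular[OF p q pq this, of "\<lambda>i. [:a i:]" "\<lambda>i. [:b i:]"]
  have "poly (fdet n F * fdet n (set_column p (\<lambda>i. [:a i:]) (set_column q (\<lambda>i. [:b i:]) F))) 0
    = poly (fdet n (set_column p (\<lambda>i. [:a i:]) F) * fdet n (set_column q (\<lambda>i. [:b i:]) F)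
      - fdet n (set_column q (\<lambda>i. [:a i:]) F) * fdet n (set_column p (\<lambda>i. [:b i:]) F)) 0"
    by (rule arg_cong)
  then show ?thesis
    by (simp add: poly_fdet set_column_def F_def if_distrib[where f = "\<lambda>P. poly P 0"] cong: if_cong)
qed

text \<open>
  Column exchange with two unit vectors inserted: every unit column reduces the determinant to a
  signed minor, and the four signs multiply to the same power of -1 in every term.
\<close>

lemma desnanot_jacobi:
  fixes f :: "nat \<Rightarrow> nat \<Rightarrow> 'a::idom"
  assumes r: "r1 < r2" "r2 < Suc (Suc n)" and c: "c1 < c2" "c2 < Suc (Suc n)"
  shows "fdet (Suc (Suc n)) f
      * fdet n (\<lambda>i j. f (insert_index r2 (insert_index r1 i)) (insert_index c2 (insert_index c1 j)))
    = minor (Suc n) f r1 c1 * minor (Suc n) f r2 c2 - minor (Suc n) f r1 c2 * minor (Suc n) f r2 c1"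
proof -
  let ?N = "Suc (Suc n)"
  let ?e = "\<lambda>r i. if i = r then 1 else 0 :: 'a"
  let ?s = "(-1) ^ (r1 + c1 + r2 + c2) :: 'a"
  have one: "fdet ?N (set_column c (?e r) g) = (-1) ^ (r + c) * minor (Suc n) g r c"
    if "r < ?N" "c < ?N" for r c g
    by (rule fdet_set_column_unit[OF that])
  have "fdet ?N (set_column c1 (?e r1) (set_column c2 (?e r2) f))
      = fdet ?N (set_column c2 (?e r2) (set_column c1 (?e r1) f))"
    using c by (intro fdet_cong) (auto simp: set_column_def)
  also have "\<dots> = (-1) ^ (r2 + c2) * minor (Suc n) (set_column c1 (?e r1) f) r2 c2"
    using r c by (intro one) auto
  also have "minor (Suc n) (set_column c1 (?e r1) f) r2 c2
      = fdet (Suc n) (set_column c1 (?e r1)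
          (\<lambda>i j. f (insert_index r2 i) (insert_index c2 j)))"
    unfolding minor_def using r c by (intro fdet_cong) (auto simp: set_column_def insert_index_def)
  also have "\<dots> = (-1) ^ (r1 + c1)
      * fdet n (\<lambda>i j. f (insert_index r2 (insert_index r1 i)) (insert_index c2 (insert_index c1 j)))"
    using r c by (subst fdet_set_column_unit) (auto simp: minor_def)
  finally have inner: "fdet ?N (set_column c1 (?e r1) (set_column c2 (?e r2) f)) = ?s *
      fdet n (\<lambda>i j. f (insert_index r2 (insert_index r1 i)) (insert_index c2 (insert_index c1 j)))"
    by (simp add: power_add algebra_simps)
  have "?s * (fdet ?N f
      * fdet n (\<lambda>i j. f (insert_index r2 (insert_index r1 i)) (insert_index c2 (insert_index c1 j))))
    = ?s * (minor (Suc n) f r1 c1 * minor (Suc n) f r2 c2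
        - minor (Suc n) f r1 c2 * minor (Suc n) f r2 c1)"
    using column_exchange[of c1 ?N c2 f "?e r1" "?e r2"] r c
    by (simp add: inner one power_add algebra_simps)
  then show ?thesis by simp
qed

section \<open>Differentiating determinants\<close>

lemma fdet_leibniz:
  "fdet n f = (\<Sum>\<pi> | \<pi> permutes {..<n}. of_int (sign \<pi>) * (\<Prod>i<n. f i (\<pi> i)))"
  unfolding fdet_def by (subst det_def'[of _ n]) (auto simp: atLeast0LessThan permutes_in_image intro!: sum.cong prod.cong)

text \<open>
  The product rule, in the form needed for functions that carry an exponential factor: if every entry
  is multiplied by a function w with w' = c w, differentiating w f amounts to applying f' + c f to
  the polynomial part, and the determinant acquires the factor w to the power n.
\<close>

lemma fdet_twisted_derivative:
  fixes f :: "nat \<Rightarrow> nat \<Rightarrow> 'a::idom poly"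
  shows "pderiv (fdet n f) + of_nat n * c * fdet n f
    = (\<Sum>r<n. fdet n (\<lambda>i j. if i = r then pderiv (f i j) + c * f i j else f i j))"
proof -
  let ?S = "{\<pi>. \<pi> permutes {..<n}}"
  let ?t = "\<lambda>\<pi>. \<Prod>i<n. f i (\<pi> i)"
  have const: "pderiv (of_int k * P) = of_int k * pderiv P" for k and P :: "'a poly"
    by (simp add: of_int_poly pderiv_smult)
  have prod_term: "(\<Sum>r<n. \<Prod>i<n. if i = r then pderiv (f i (\<pi> i)) + c * f i (\<pi> i) else f i (\<pi> i))
      = pderiv (?t \<pi>) + of_nat n * c * ?t \<pi>" for \<pi>
  proof -
    have "(\<Prod>i<n. if i = r then pderiv (f i (\<pi> i)) + c * f i (\<pi> i) else f i (\<pi> i))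
        = (\<Prod>i\<in>{..<n} - {r}. f i (\<pi> i)) * pderiv (f r (\<pi> r)) + c * ?t \<pi>" if r: "r \<in> {..<n}" for r
      using r by (simp add: prod.remove[OF _ r] algebra_simps)
    then show ?thesis
      by (simp add: pderiv_prod sum.distrib mult.assoc)
  qed
  have "(\<Sum>r<n. fdet n (\<lambda>i j. if i = r then pderiv (f i j) + c * f i j else f i j))
      = (\<Sum>\<pi>\<in>?S. of_int (sign \<pi>) *
          (\<Sum>r<n. \<Prod>i<n. if i = r then pderiv (f i (\<pi> i)) + c * f i (\<pi> i) else f i (\<pi> i)))"
    unfolding fdet_leibniz by (subst sum.swap) (simp add: sum_distrib_left)
  also have "\<dots> = (\<Sum>\<pi>\<in>?S. pderiv (of_int (sign \<pi>) * ?t \<pi>)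
      + of_nat n * c * (of_int (sign \<pi>) * ?t \<pi>))"
    by (simp only: prod_term const) (simp add: algebra_simps)
  also have "\<dots> = pderiv (fdet n f) + of_nat n * c * fdet n f"
    by (simp only: fdet_leibniz sum.distrib pderiv_sum sum_distrib_left)
  finally show ?thesis by simp
qed

text \<open>
  When each row is the twisted derivative of the row above, differentiating any row but the last one
  duplicates the next row. Only the last row contributes, and it becomes the row that was deleted.
\<close>

lemma minor_row_shift:
  fixes f :: "nat \<Rightarrow> nat \<Rightarrow> 'a::idom poly"
  assumes "\<And>i j. i \<le> n \<Longrightarrow> f (Suc i) j = pderiv (f i j) + c * f i j"
  shows "pderiv (minor (Suc n) f (Suc n) k) + of_nat (Suc n) * c * minor (Suc n) f (Suc n) k
    = minor (Suc n) f n k"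
proof -
  let ?g = "\<lambda>i j. f i (insert_index k j)"
  let ?G = "\<lambda>r. fdet (Suc n) (\<lambda>i j. if i = r then ?g (Suc i) j else ?g i j)"
  have last_deleted: "minor (Suc n) f (Suc n) k = fdet (Suc n) ?g"
    unfolding minor_def by (rule fdet_cong) auto
  have "pderiv (fdet (Suc n) ?g) + of_nat (Suc n) * c * fdet (Suc n) ?g = (\<Sum>r<Suc n. ?G r)"
    unfolding fdet_twisted_derivative
    by (intro sum.cong refl fdet_cong) (simp add: assms)
  also have "\<dots> = ?G n"
  proof -
    have "?G r = 0" if "r < n" for r
      by (rule fdet_equal_rows[of r "Suc r"]) (use that in auto)
    then show ?thesis by simp
  qed
  also have "\<dots> = minor (Suc n) f n k"
    unfolding minor_def by (rule fdet_cong) (auto simp: insert_index_def)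
  finally show ?thesis by (simp only: last_deleted)
qed

lemma minor_transpose: "minor n (\<lambda>i j. f j i) r c = minor n f c r"
  unfolding minor_def
  by (rule fdet_transpose[of n "\<lambda>i j. f (insert_index c i) (insert_index r j)"])

lemma minor_column_shift:
  fixes f :: "nat \<Rightarrow> nat \<Rightarrow> 'a::idom poly"
  assumes "\<And>i j. j \<le> n \<Longrightarrow> f i (Suc j) = pderiv (f i j) + c * f i j"
  shows "pderiv (minor (Suc n) f k (Suc n)) + of_nat (Suc n) * c * minor (Suc n) f k (Suc n)
    = minor (Suc n) f k n"
  using minor_row_shift[of n "\<lambda>i j. f j i" c k] assms by (simp only: minor_transpose[of _ f])

lemma fdet_unitriangular_row_operation:
  "fdet n (\<lambda>i j. f i j + (\<Sum>k<i. a i k * f k j)) = fdet n f"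
proof -
  let ?L = "mat n n (\<lambda>(i, k). if k < i then a i k else if k = i then 1 else 0)"
  let ?M = "mat n n (\<lambda>(i, j). f i j)"
  have "mat n n (\<lambda>(i, j). f i j + (\<Sum>k<i. a i k * f k j)) = ?L * ?M"
  proof (rule eq_matI)
    fix i j assume "i < dim_row (?L * ?M)" "j < dim_col (?L * ?M)"
    then have ij: "i < n" "j < n" by auto
    have "(?L * ?M) $$ (i, j)
        = (\<Sum>k<n. (if k < i then a i k else if k = i then 1 else 0) * f k j)"
      using ij by (simp add: scalar_prod_def atLeast0LessThan)
    also have "\<dots> = (\<Sum>k\<in>insert i {..<i}.
        (if k < i then a i k else if k = i then 1 else 0) * f k j)"
      by (rule sum.mono_neutral_right) (use ij in auto)
    also have "\<dots> = f i j + (\<Sum>k<i. a i k * f k j)"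
      by simp
    finally show "mat n n (\<lambda>(i, j). f i j + (\<Sum>k<i. a i k * f k j)) $$ (i, j) = (?L * ?M) $$ (i, j)"
      using ij by simp
  qed auto
  moreover have "det ?L = 1"
    by (subst det_lower_triangular[of n]) (auto simp: prod_list_diag_prod)
  ultimately show ?thesis
    unfolding fdet_def by (simp add: det_mult[of _ n])
qed

text \<open>
  The coefficients depend on i and c only; multiplying by an exponential factor therefore acts on the
  rows of a Wronskian by a unitriangular matrix.
\<close>

lemma twisted_derivative_power:
  fixes c :: "'a::idom poly"
  shows "\<exists>a. \<forall>q. ((\<lambda>q. pderiv q + c * q) ^^ i) q
    = (pderiv ^^ i) q + (\<Sum>k<i. a k * (pderiv ^^ k) q)"
proof -
  define T where "T = (\<lambda>q. pderiv q + c * q)"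
  have T_apply: "T q = pderiv q + c * q" for q
    by (simp add: T_def)
  have "\<exists>a. \<forall>q. (T ^^ i) q = (pderiv ^^ i) q + (\<Sum>k<i. a k * (pderiv ^^ k) q)"
  proof (induction i)
    case 0
    show ?case by simp
  next
    case (Suc i)
    then obtain a where a: "(T ^^ i) q
      = (pderiv ^^ i) q + (\<Sum>k<i. a k * (pderiv ^^ k) q)" for q
      by blast
    define b where "b k = (if k = i then c else pderiv (a k) + c * a k)
      + (case k of 0 \<Rightarrow> 0 | Suc k' \<Rightarrow> a k')" for k
    have "(T ^^ Suc i) q
      = (pderiv ^^ Suc i) q + (\<Sum>k<Suc i. b k * (pderiv ^^ k) q)" for q
    proof -
      have "(\<Sum>k<Suc i. b k * (pderiv ^^ k) q)
        = (\<Sum>k<Suc i. (if k = i then c else pderiv (a k) + c * a k) * (pderiv ^^ k) q)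
          + (\<Sum>k<Suc i. (case k of 0 \<Rightarrow> 0 | Suc k' \<Rightarrow> a k') * (pderiv ^^ k) q)"
        by (simp only: b_def distrib_right sum.distrib)
      also have "(\<Sum>k<Suc i. (case k of 0 \<Rightarrow> 0 | Suc k' \<Rightarrow> a k') * (pderiv ^^ k) q)
        = (\<Sum>k<i. a k * (pderiv ^^ Suc k) q)"
        by (simp add: sum.lessThan_Suc_shift del: sum.lessThan_Suc)
      finally show ?thesis
        by (simp add: a T_apply pderiv_add pderiv_sum pderiv_mult sum_distrib_left sum.distrib
            algebra_simps)
    qed
    then show ?case by blast
  qed
  then show ?thesis unfolding T_def .
qed

lemma fdet_twisted_wronskian:
  fixes c :: "'a::idom poly"
  shows "fdet n (\<lambda>i j. ((\<lambda>q. pderiv q + c * q) ^^ i) (q j)) = fdet n (\<lambda>i j. (pderiv ^^ i) (q j))"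
proof -
  have "\<forall>i. \<exists>a. \<forall>q. ((\<lambda>q. pderiv q + c * q) ^^ i) q
    = (pderiv ^^ i) q + (\<Sum>k<i. a k * (pderiv ^^ k) q)"
    by (intro allI twisted_derivative_power)
  from choice[OF this] obtain a where a: "\<forall>i q. ((\<lambda>q. pderiv q + c * q) ^^ i) q
    = (pderiv ^^ i) q + (\<Sum>k<i. a i k * (pderiv ^^ k) q)"
    by (elim exE)
  show ?thesis
    by (simp only: a[rule_format] fdet_unitriangular_row_operation)
qed

section \<open>Hankel determinants of the derivatives of the Gaussian\<close>

text \<open>
  The k-th derivative of exp(-z^2) is the k-th of these polynomials times exp(-z^2); up to the sign
  (-1)^k they are the classical Hermite polynomials.
\<close>

primrec gauss_poly :: "nat \<Rightarrow> real poly" where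
  "gauss_poly 0 = 1"
| "gauss_poly (Suc k) = pderiv (gauss_poly k) + [:0, -2:] * gauss_poly k"

lemmas gauss_poly_rec = gauss_poly.simps(2)
declare gauss_poly_rec [simp del]

lemma pderiv_gauss_poly: "pderiv (gauss_poly k) = smult (- 2 * real k) (gauss_poly (k - 1))"
proof (induction k)
  case 0
  show ?case by simp
next
  case (Suc k)
  have "pderiv (gauss_poly (Suc k))
      = pderiv (pderiv (gauss_poly k)) + [:0, -2:] * pderiv (gauss_poly k) - smult 2 (gauss_poly k)"
    by (simp add: gauss_poly_rec pderiv_add pderiv_mult pderiv_pCons pderiv_smult pderiv_minus)
  also have "pderiv (pderiv (gauss_poly k)) + [:0, -2:] * pderiv (gauss_poly k)
      = smult (- 2 * real k) (gauss_poly k)"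
  proof (cases k)
    case (Suc l)
    show ?thesis
      unfolding Suc.IH unfolding Suc
      by (simp add: gauss_poly_rec[of l] pderiv_smult smult_add_right)
  qed simp
  also have "smult (- 2 * real k) (gauss_poly k) - smult 2 (gauss_poly k)
      = smult (- 2 * real (Suc k)) (gauss_poly k)"
  proof -
    have "- 2 * real k - 2 = - 2 * real (Suc k)" by simp
    then show ?thesis by (simp only: smult_diff_left[symmetric])
  qed
  finally show ?case by simp
qed

text \<open>
  Up to the factor exp(-n z^2), the Hankel determinant of the derivatives of the Gaussian of orders
  m, ..., m + 2n - 2, which is also the Wronskian of the derivatives of orders m, ..., m + n - 1.
\<close>

definition hankel :: "nat \<Rightarrow> nat \<Rightarrow> real poly" where
  "hankel m n = fdet n (\<lambda>i j. gauss_poly (m + i + j))"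

lemma hankel_0 [simp]: "hankel m 0 = 1"
  by (simp add: hankel_def)

lemma hankel_1: "hankel m (Suc 0) = gauss_poly m"
  by (simp add: hankel_def fdet_1)

text \<open>
  The Gaussian factor is removed from the Wronskian by unitriangular row operations. What remains is
  the Wronskian of polynomials whose derivatives are multiples of their predecessors, so the same
  determinant also has an essentially Toeplitz form.
\<close>

lemma hankel_eq_wronskian: "hankel m n = fdet n (\<lambda>i j. (pderiv ^^ i) (gauss_poly (m + j)))"
proof -
  define T where "T = (\<lambda>q :: real poly. pderiv q + [:0, -2:] * q)"
  have "(T ^^ i) (gauss_poly k) = gauss_poly (k + i)" for i k
  proof (induction i)
    case (Suc i)
    then show ?case
      by (simp only: funpow.simps comp_apply) (simp only: T_def gauss_poly_rec add_Suc_right)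
  qed simp
  then have "hankel m n = fdet n (\<lambda>i j. (T ^^ i) (gauss_poly (m + j)))"
    unfolding hankel_def by (intro fdet_cong) (simp only: ac_simps)
  then show ?thesis
    by (simp only: T_def fdet_twisted_wronskian)
qed

lemma hankel_minors:
  "minor n (\<lambda>i j. gauss_poly (m + i + j)) n n = hankel m n"
  "minor n (\<lambda>i j. gauss_poly (m + i + j)) n 0 = hankel (Suc m) n"
  "minor n (\<lambda>i j. gauss_poly (m + i + j)) 0 n = hankel (Suc m) n"
  "minor n (\<lambda>i j. gauss_poly (m + i + j)) 0 0 = hankel (Suc (Suc m)) n"
  unfolding minor_def hankel_def by (rule fdet_cong; simp add: insert_index_def)+

text \<open>
  Desnanot-Jacobi for the first and last row and column.
\<close>

lemma hankel_dodgson: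
  "hankel m (Suc (Suc n)) * hankel (Suc (Suc m)) n
    = hankel (Suc (Suc m)) (Suc n) * hankel m (Suc n) - (hankel (Suc m) (Suc n))\<^sup>2"
proof -
  let ?f = "\<lambda>i j. gauss_poly (m + i + j)"
  have "fdet n (\<lambda>i j. ?f (insert_index (Suc n) (insert_index 0 i)) (insert_index (Suc n) (insert_index 0 j)))
      = hankel (Suc (Suc m)) n"
    unfolding hankel_def by (rule fdet_cong) (auto simp: insert_index_def)
  then show ?thesis
    using desnanot_jacobi[of 0 "Suc n" n 0 "Suc n" ?f, OF zero_less_Suc lessI zero_less_Suc lessI]
    by (simp only: hankel_minors power2_eq_square hankel_def[of m "Suc (Suc n)", symmetric])
qed

lemma hankel_shift_row:
  "minor (Suc n) (\<lambda>i j. gauss_poly (m + i + j)) n k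
    = pderiv (minor (Suc n) (\<lambda>i j. gauss_poly (m + i + j)) (Suc n) k)
      + of_nat (Suc n) * [:0, -2:] * minor (Suc n) (\<lambda>i j. gauss_poly (m + i + j)) (Suc n) k"
  by (rule minor_row_shift[symmetric]) (simp add: gauss_poly_rec)

lemma hankel_shift_column:
  "minor (Suc n) (\<lambda>i j. gauss_poly (m + i + j)) k n
    = pderiv (minor (Suc n) (\<lambda>i j. gauss_poly (m + i + j)) k (Suc n))
      + of_nat (Suc n) * [:0, -2:] * minor (Suc n) (\<lambda>i j. gauss_poly (m + i + j)) k (Suc n)"
  by (rule minor_column_shift[symmetric]) (simp add: gauss_poly_rec)

text \<open>
  Desnanot-Jacobi for the last two rows and the outer two columns. The minors that keep the last row
  but not the row before are twisted derivatives; the twists cancel in the difference.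
\<close>

lemma hankel_wronskian_pair:
  "hankel m (Suc n) * pderiv (hankel (Suc m) (Suc n)) - pderiv (hankel m (Suc n)) * hankel (Suc m) (Suc n)
    = hankel m (Suc (Suc n)) * hankel (Suc m) n"
proof -
  let ?f = "\<lambda>i j. gauss_poly (m + i + j)"
  have "fdet n (\<lambda>i j. ?f (insert_index (Suc n) (insert_index n i)) (insert_index (Suc n) (insert_index 0 j)))
      = hankel (Suc m) n"
    unfolding hankel_def by (rule fdet_cong) (auto simp: insert_index_def)
  then have "hankel m (Suc (Suc n)) * hankel (Suc m) n
      = minor (Suc n) ?f n 0 * hankel m (Suc n) - minor (Suc n) ?f n (Suc n) * hankel (Suc m) (Suc n)"
    using desnanot_jacobi[of n "Suc n" n 0 "Suc n" ?f, OF lessI lessI zero_less_Suc lessI]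
    by (simp only: hankel_minors hankel_def[of m "Suc (Suc n)", symmetric])
  then show ?thesis
    by (simp only: hankel_shift_row hankel_minors) (simp add: algebra_simps)
qed

text \<open>
  The Toda equation: Desnanot-Jacobi for the last two rows and columns, where the minors are the
  determinant and its first and second twisted derivatives. The derivative of the twist -2(n + 1)z is
  what produces the last term.
\<close>

lemma hankel_toda:
  "hankel m (Suc (Suc n)) * hankel m n
    = hankel m (Suc n) * pderiv (pderiv (hankel m (Suc n))) - (pderiv (hankel m (Suc n)))\<^sup>2
      - 2 * of_nat (Suc n) * (hankel m (Suc n))\<^sup>2"
proof -
  let ?f = "\<lambda>i j. gauss_poly (m + i + j)"
  let ?h = "hankel m (Suc n)"
  define w :: "real poly" where "w = of_nat (Suc n) * [:0, -2:]"
  have w': "pderiv w = - 2 * of_nat (Suc n)"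
    unfolding w_def by (simp add: pderiv_mult pderiv_pCons of_nat_poly numeral_poly)
  have inner: "fdet n (\<lambda>i j. ?f (insert_index (Suc n) (insert_index n i)) (insert_index (Suc n) (insert_index n j)))
      = hankel m n"
    unfolding hankel_def by (rule fdet_cong) (simp add: insert_index_def)
  have col: "minor (Suc n) ?f (Suc n) n = pderiv ?h + w * ?h"
    by (simp only: hankel_shift_column hankel_minors w_def)
  have row: "minor (Suc n) ?f n (Suc n) = pderiv ?h + w * ?h"
    by (simp only: hankel_shift_row hankel_minors w_def)
  have both: "minor (Suc n) ?f n n = pderiv (pderiv ?h + w * ?h) + w * (pderiv ?h + w * ?h)"
    by (simp only: hankel_shift_row[of n m n] col w_def)
  have "hankel m (Suc (Suc n)) * hankel m n
      = (pderiv (pderiv ?h + w * ?h) + w * (pderiv ?h + w * ?h)) * ?h - (pderiv ?h + w * ?h)\<^sup>2"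
    using desnanot_jacobi[of n "Suc n" n n "Suc n" ?f, OF lessI lessI lessI lessI]
    by (simp only: inner hankel_minors col row both power2_eq_square hankel_def[of m "Suc (Suc n)", symmetric])
  also have "\<dots> = ?h * pderiv (pderiv ?h) - (pderiv ?h)\<^sup>2 + pderiv w * ?h\<^sup>2"
    by (simp add: pderiv_add pderiv_mult power2_eq_square algebra_simps)
  finally show ?thesis
    by (simp add: w' algebra_simps del: of_nat_Suc)
qed

text \<open>
  Desnanot-Jacobi for the Wronskian form and its first and last row and column. Deleting the first
  row leaves derivatives, and pulling their scalar factors out of the columns gives a determinant of
  the same kind. The factors of the two products differ only at the ends of the ranges, which is the
  source of the coefficients m and m + n.
\<close>

lemma hankel_two_direction:
  "hankel m (Suc (Suc n)) * hankel m n
    = 2 * of_nat m * hankel (Suc m) (Suc n) * hankel (m - 1) (Suc n)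
      - 2 * of_nat (m + Suc n) * (hankel m (Suc n))\<^sup>2"
proof -
  let ?f = "\<lambda>i j. (pderiv ^^ i) (gauss_poly (m + j))"
  define c :: "nat \<Rightarrow> real poly" where "c k = [:- 2 * real k:]" for k
  have D: "(pderiv ^^ Suc i) (gauss_poly k) = c k * (pderiv ^^ i) (gauss_poly (k - 1))" for i k
    by (induction i) (simp_all add: pderiv_gauss_poly pderiv_smult pderiv_minus c_def)
  define P where "P = (\<Prod>j<n. c (m + Suc j))"
  have inner: "fdet n (\<lambda>i j. ?f (insert_index (Suc n) (insert_index 0 i)) (insert_index (Suc n) (insert_index 0 j)))
      = P * hankel m n"
    unfolding hankel_eq_wronskian P_def fdet_scale_columns[symmetric]
    by (rule fdet_cong) (simp add: insert_index_def D del: funpow.simps)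
  have first: "minor (Suc n) ?f 0 0 = P * c (m + Suc n) * hankel m (Suc n)"
  proof -
    have "minor (Suc n) ?f 0 0 = (\<Prod>j<Suc n. c (m + Suc j)) * hankel m (Suc n)"
      unfolding hankel_eq_wronskian fdet_scale_columns[symmetric] minor_def
      by (rule fdet_cong) (simp add: insert_index_def D del: funpow.simps)
    then show ?thesis by (simp add: P_def)
  qed
  \<comment> \<open>For m = 0 the first column of this minor vanishes, which accounts for the truncated index m - 1.\<close>
  have mixed: "minor (Suc n) ?f 0 (Suc n) = c m * P * hankel (m - 1) (Suc n)"
  proof (cases m)
    case 0
    have "minor (Suc n) ?f 0 (Suc n) = (\<Prod>j<Suc n. c (m + j)) * fdet (Suc n) (\<lambda>i j. (pderiv ^^ i) (gauss_poly (m + j - 1)))"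
      unfolding fdet_scale_columns[symmetric] minor_def
      by (rule fdet_cong) (simp add: insert_index_def D del: funpow.simps)
    also have "\<dots> = 0" using 0 by (simp add: c_def prod.lessThan_Suc_shift del: prod.lessThan_Suc)
    finally show ?thesis using 0 by (simp add: c_def)
  next
    case (Suc l)
    have "minor (Suc n) ?f 0 (Suc n) = (\<Prod>j<Suc n. c (m + j)) * hankel l (Suc n)"
      unfolding hankel_eq_wronskian fdet_scale_columns[symmetric] minor_def
      by (rule fdet_cong) (simp add: insert_index_def D Suc del: funpow.simps)
    also have "(\<Prod>j<Suc n. c (m + j)) = c m * P"
      by (simp add: P_def prod.lessThan_Suc_shift del: prod.lessThan_Suc)
    finally show ?thesis by (simp add: Suc)
  qed
  have rest: "minor (Suc n) ?f (Suc n) (Suc n) = hankel m (Suc n)"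
      "minor (Suc n) ?f (Suc n) 0 = hankel (Suc m) (Suc n)"
    unfolding hankel_eq_wronskian minor_def by (rule fdet_cong; simp)+
  have "P * (hankel m (Suc (Suc n)) * hankel m n)
      = P * (c (m + Suc n) * (hankel m (Suc n))\<^sup>2 - c m * hankel (m - 1) (Suc n) * hankel (Suc m) (Suc n))"
    using desnanot_jacobi[of 0 "Suc n" n 0 "Suc n" ?f, OF zero_less_Suc lessI zero_less_Suc lessI]
    by (simp only: inner first mixed rest hankel_eq_wronskian[of m "Suc (Suc n)", symmetric])
       (simp add: power2_eq_square algebra_simps)
  moreover have "P \<noteq> 0"
    by (simp add: P_def c_def)
  ultimately have "hankel m (Suc (Suc n)) * hankel m n
      = c (m + Suc n) * (hankel m (Suc n))\<^sup>2 - c m * hankel (m - 1) (Suc n) * hankel (Suc m) (Suc n)"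
    by simp
  also have "\<dots> = 2 * of_nat m * hankel (Suc m) (Suc n) * hankel (m - 1) (Suc n)
      - 2 * of_nat (m + Suc n) * (hankel m (Suc n))\<^sup>2"
  proof -
    have "c k = - (2 * of_nat k)" for k
      by (simp add: c_def of_nat_poly numeral_poly)
    then show ?thesis by (simp add: algebra_simps)
  qed
  finally show ?thesis .
qed

section \<open>The normalised polynomials and their bilinear identities\<close>

text \<open>
  The value of the Hankel determinant of order n for m = 0, which is a constant polynomial.
\<close>

definition gauss_superfactorial :: "nat \<Rightarrow> real" where
  "gauss_superfactorial n = (\<Prod>i<n. (-2) ^ i * fact i)"

lemma gauss_superfactorial_nonzero: "gauss_superfactorial n \<noteq> 0"
  by (simp add: gauss_superfactorial_def)

lemma gauss_superfactorial_rec: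
  "gauss_superfactorial (Suc (Suc n)) * gauss_superfactorial n
    = - 2 * real (Suc n) * (gauss_superfactorial (Suc n))\<^sup>2"
  by (simp add: gauss_superfactorial_def power2_eq_square algebra_simps)

text \<open>
  Dividing by the value at m = 0 makes the row m = 0 constantly 1, and the sign makes every leading
  coefficient positive. Both factors are geometric in m, and in the direction of n their ratio is the
  factor -1/(2n) by which the Toda equation differs from the recurrence.
\<close>

definition hermite :: "nat \<Rightarrow> nat \<Rightarrow> real poly" where
  "hermite m n = smult ((-1) ^ (m * n) / gauss_superfactorial n) (hankel m n)"

lemma hermite_0_right: "hermite m 0 = 1"
  by (simp add: hermite_def gauss_superfactorial_def)

lemma hermite_1: "hermite m (Suc 0) = smult ((-1) ^ m) (gauss_poly m)"
  by (simp add: hermite_def gauss_superfactorial_def hankel_1)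

lemma sign_square: "(-1 :: real) ^ k * (-1) ^ k = 1"
  by (simp flip: power_add)

lemma normalization_product:
  assumes "even (a + b)"
  shows "2 * real (Suc n) * (((-1) ^ a / gauss_superfactorial (Suc (Suc n)))
      * ((-1) ^ b / gauss_superfactorial n))
    = - (1 / (gauss_superfactorial (Suc n))\<^sup>2)"
proof -
  have "((-1) ^ a / gauss_superfactorial (Suc (Suc n))) * ((-1) ^ b / gauss_superfactorial n)
      = (-1) ^ (a + b) / (gauss_superfactorial (Suc (Suc n)) * gauss_superfactorial n)"
    by (simp add: power_add)
  also have "\<dots> = 1 / (- 2 * real (Suc n) * (gauss_superfactorial (Suc n))\<^sup>2)"
    using assms by (simp only: gauss_superfactorial_rec) simp
  finally show ?thesis
    using gauss_superfactorial_nonzero[of "Suc n"] by (simp add: field_simps del: of_nat_Suc)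
qed

lemma hermite_two_steps:
  assumes "even (a * Suc (Suc n) + b * n)"
  shows "2 * of_nat (Suc n) * hermite a (Suc (Suc n)) * hermite b n
    = smult (- (1 / (gauss_superfactorial (Suc n))\<^sup>2)) (hankel a (Suc (Suc n)) * hankel b n)"
proof -
  have "2 * of_nat (Suc n) * hermite a (Suc (Suc n)) * hermite b n
      = smult (2 * real (Suc n) * (((-1) ^ (a * Suc (Suc n)) / gauss_superfactorial (Suc (Suc n)))
      * ((-1) ^ (b * n) / gauss_superfactorial n))) (hankel a (Suc (Suc n)) * hankel b n)"
    by (simp only: hermite_def of_nat_poly numeral_poly) (simp add: mult_ac)
  then show ?thesis
    by (simp only: normalization_product[OF assms])
qed

lemma hermite_one_step:
  assumes "even ((a + b) * n)"
  shows "hermite a n * hermite b n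
    = smult (1 / (gauss_superfactorial n)\<^sup>2) (hankel a n * hankel b n)"
proof -
  have "((-1) ^ (b * n) * (-1) ^ (a * n) :: real) = 1"
    using assms by (simp add: distrib_right add.commute flip: power_add)
  then show ?thesis
    by (simp add: hermite_def power2_eq_square)
qed

lemma hermite_wronskian_form:
  "hermite m n * pderiv (pderiv (hermite m n)) - (pderiv (hermite m n))\<^sup>2
    = smult (1 / (gauss_superfactorial n)\<^sup>2)
        (hankel m n * pderiv (pderiv (hankel m n)) - (pderiv (hankel m n))\<^sup>2)"
proof -
  define s where "s = (-1) ^ (m * n) / gauss_superfactorial n"
  have "s * s = 1 / (gauss_superfactorial n)\<^sup>2"
    by (simp add: s_def power2_eq_square sign_square)
  then show ?thesis
    by (simp add: hermite_def pderiv_smult power2_eq_square smult_diff_right flip: s_def)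
qed

lemma hermite_rec_right:
  "2 * of_nat (Suc n) * hermite m (Suc (Suc n)) * hermite m n
    = - (hermite m (Suc n) * pderiv (pderiv (hermite m (Suc n)))) + (pderiv (hermite m (Suc n)))\<^sup>2
      + 2 * of_nat (Suc n) * (hermite m (Suc n))\<^sup>2"
proof -
  let ?s = "1 / (gauss_superfactorial (Suc n))\<^sup>2"
  have sq: "(hermite m (Suc n))\<^sup>2 = smult ?s ((hankel m (Suc n))\<^sup>2)"
    using hermite_one_step[of m m "Suc n"] by (simp add: power2_eq_square)
  have "2 * of_nat (Suc n) * hermite m (Suc (Suc n)) * hermite m n
      = smult (- ?s) (hankel m (Suc n) * pderiv (pderiv (hankel m (Suc n)))
        - (pderiv (hankel m (Suc n)))\<^sup>2 - 2 * of_nat (Suc n) * (hankel m (Suc n))\<^sup>2)"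
    by (subst hermite_two_steps) (auto simp: hankel_toda)
  also have "\<dots> = - smult ?s (hankel m (Suc n) * pderiv (pderiv (hankel m (Suc n)))
        - (pderiv (hankel m (Suc n)))\<^sup>2) + 2 * of_nat (Suc n) * smult ?s ((hankel m (Suc n))\<^sup>2)"
    by (simp add: smult_diff_right)
  also have "\<dots> = - (hermite m (Suc n) * pderiv (pderiv (hermite m (Suc n))) - (pderiv (hermite m (Suc n)))\<^sup>2)
      + 2 * of_nat (Suc n) * (hermite m (Suc n))\<^sup>2"
    by (simp only: hermite_wronskian_form sq)
  finally show ?thesis
    by simp
qed

text \<open>
  The Toda equation and the two-direction identity express the same product of neighbours in the direction of n; equating
  them leaves the recurrence in the direction of m, whose normalising constants cancel because they
  are geometric in m.
\<close>

lemma hermite_rec_left: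
  "2 * of_nat (Suc m) * hermite (Suc (Suc m)) n * hermite m n
    = hermite (Suc m) n * pderiv (pderiv (hermite (Suc m) n)) - (pderiv (hermite (Suc m) n))\<^sup>2
      + 2 * of_nat (Suc m) * (hermite (Suc m) n)\<^sup>2"
proof (cases n)
  case 0
  then show ?thesis by (simp add: hermite_0_right)
next
  case (Suc k)
  let ?h = "hankel (Suc m) n"
  let ?s = "1 / (gauss_superfactorial n)\<^sup>2"
  have "2 * of_nat (Suc m) * (hankel (Suc (Suc m)) n * hankel m n)
      = ?h * pderiv (pderiv ?h) - (pderiv ?h)\<^sup>2 + 2 * of_nat (Suc m) * ?h\<^sup>2"
    using hankel_toda[of "Suc m" k] hankel_two_direction[of "Suc m" k]
    by (simp add: Suc algebra_simps)
  then have "smult ?s (2 * of_nat (Suc m) * (hankel (Suc (Suc m)) n * hankel m n))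
      = smult ?s (?h * pderiv (pderiv ?h) - (pderiv ?h)\<^sup>2) + smult ?s (2 * of_nat (Suc m) * ?h\<^sup>2)"
    by (simp only: smult_add_right)
  moreover have "hermite (Suc (Suc m)) n * hermite m n = smult ?s (hankel (Suc (Suc m)) n * hankel m n)"
    by (rule hermite_one_step) simp
  moreover have "(hermite (Suc m) n)\<^sup>2 = smult ?s (?h\<^sup>2)"
    using hermite_one_step[of "Suc m" "Suc m" n] by (simp add: power2_eq_square)
  ultimately show ?thesis
    by (simp only: hermite_wronskian_form mult_smult_right mult.assoc)
qed

text \<open>
  Eliminating the neighbours in the direction of m between the two-direction identity and the Dodgson
  identity. All coefficients on the right are positive, which is what forces positivity for
  even n.
\<close>

lemma hermite_positivity_identity:
  "hermite (Suc m) (Suc (Suc n)) * hermite (Suc m) n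
    = (hermite (Suc m) (Suc n))\<^sup>2
      + 2 * of_nat (Suc m) * hermite m (Suc (Suc n)) * hermite (Suc (Suc m)) n"
proof -
  let ?N = "of_nat (Suc n) :: real poly" and ?M = "of_nat (Suc m) :: real poly"
  let ?s = "1 / (gauss_superfactorial (Suc n))\<^sup>2"
  have "hankel (Suc m) (Suc (Suc n)) * hankel (Suc m) n
      = 2 * ?M * (hankel m (Suc (Suc n)) * hankel (Suc (Suc m)) n) - 2 * ?N * (hankel (Suc m) (Suc n))\<^sup>2"
  proof -
    have "hankel (Suc (Suc m)) (Suc n) * hankel m (Suc n)
        = hankel m (Suc (Suc n)) * hankel (Suc (Suc m)) n + (hankel (Suc m) (Suc n))\<^sup>2"
      by (simp add: hankel_dodgson)
    moreover have "hankel (Suc m) (Suc (Suc n)) * hankel (Suc m) n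
        = 2 * ?M * (hankel (Suc (Suc m)) (Suc n) * hankel m (Suc n))
          - 2 * of_nat (Suc m + Suc n) * (hankel (Suc m) (Suc n))\<^sup>2"
      using hankel_two_direction[of "Suc m" n] by (simp only: diff_Suc_1 mult.assoc)
    ultimately show ?thesis
      by (simp add: algebra_simps)
  qed
  then have "smult (- ?s) (hankel (Suc m) (Suc (Suc n)) * hankel (Suc m) n)
      = 2 * ?M * smult (- ?s) (hankel m (Suc (Suc n)) * hankel (Suc (Suc m)) n)
        + 2 * ?N * smult ?s ((hankel (Suc m) (Suc n))\<^sup>2)"
    by (simp only: smult_diff_right smult_minus_left mult_smult_right) simp
  moreover have "2 * ?N * hermite (Suc m) (Suc (Suc n)) * hermite (Suc m) n
      = smult (- ?s) (hankel (Suc m) (Suc (Suc n)) * hankel (Suc m) n)"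
    by (rule hermite_two_steps) auto
  moreover have "2 * ?N * hermite m (Suc (Suc n)) * hermite (Suc (Suc m)) n
      = smult (- ?s) (hankel m (Suc (Suc n)) * hankel (Suc (Suc m)) n)"
    by (rule hermite_two_steps) auto
  moreover have "(hermite (Suc m) (Suc n))\<^sup>2 = smult ?s ((hankel (Suc m) (Suc n))\<^sup>2)"
    using hermite_one_step[of "Suc m" "Suc m" "Suc n"] by (simp add: power2_eq_square)
  ultimately have "2 * ?N * (hermite (Suc m) (Suc (Suc n)) * hermite (Suc m) n)
      = 2 * ?N * ((hermite (Suc m) (Suc n))\<^sup>2
      + 2 * ?M * hermite m (Suc (Suc n)) * hermite (Suc (Suc m)) n)"
    by (simp only: distrib_left mult_ac add_ac)
  then show ?thesis
    by (simp only: mult_cancel_left) (simp del: of_nat_Suc)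
qed

lemma hermite_wronskian_pair:
  "hermite m (Suc n) * pderiv (hermite (Suc m) (Suc n)) - pderiv (hermite m (Suc n)) * hermite (Suc m) (Suc n)
    = 2 * of_nat (Suc n) * hermite m (Suc (Suc n)) * hermite (Suc m) n"
proof -
  let ?K = "gauss_superfactorial"
  define s where "s = (-1) ^ (m * Suc n) / ?K (Suc n)"
  define t where "t = (-1) ^ (Suc m * Suc n) / ?K (Suc n)"
  define u where "u = (-1) ^ (m * Suc (Suc n)) / ?K (Suc (Suc n))"
  define v where "v = (-1) ^ (Suc m * n) / ?K n"
  have st: "s * t = (-1) ^ Suc n / (?K (Suc n))\<^sup>2"
  proof -
    have "(-1 :: real) ^ (m * Suc n) * (-1) ^ (Suc m * Suc n) = (-1) ^ (2 * (m * Suc n) + Suc n)"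
    proof -
      have "m * Suc n + Suc m * Suc n = 2 * (m * Suc n) + Suc n" by simp
      then show ?thesis by (simp only: power_add[symmetric])
    qed
    also have "\<dots> = (-1) ^ Suc n"
      by (simp only: power_add power_mult) simp
    finally show ?thesis
      by (simp only: s_def t_def power2_eq_square times_divide_times_eq)
  qed
  have "u * v = (-1) ^ n / (?K (Suc (Suc n)) * ?K n)"
  proof -
    have "(-1 :: real) ^ (m * Suc (Suc n)) * (-1) ^ (Suc m * n) = (-1) ^ (2 * (m * Suc n) + n)"
    proof -
      have "m * Suc (Suc n) + Suc m * n = 2 * (m * Suc n) + n" by simp
      then show ?thesis by (simp only: power_add[symmetric])
    qed
    also have "\<dots> = (-1) ^ n"
      by (simp only: power_add power_mult) simp
    finally show ?thesis
      by (simp only: u_def v_def times_divide_times_eq)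
  qed
  also have "\<dots> = (-1) ^ Suc n / (2 * real (Suc n) * (?K (Suc n))\<^sup>2)"
    by (simp only: gauss_superfactorial_rec) (simp del: of_nat_Suc)
  finally have uv: "2 * real (Suc n) * (u * v) = s * t"
    by (simp add: st field_simps del: of_nat_Suc)
  have "hermite m (Suc n) * pderiv (hermite (Suc m) (Suc n)) - pderiv (hermite m (Suc n)) * hermite (Suc m) (Suc n)
      = smult (s * t) (hankel m (Suc n) * pderiv (hankel (Suc m) (Suc n))
          - pderiv (hankel m (Suc n)) * hankel (Suc m) (Suc n))"
    by (simp only: hermite_def s_def[symmetric] t_def[symmetric] pderiv_smult)
       (simp add: smult_diff_right mult.commute[of s t])
  also have "\<dots> = smult (2 * real (Suc n) * (u * v)) (hankel m (Suc (Suc n)) * hankel (Suc m) n)"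
    by (simp only: hankel_wronskian_pair uv)
  also have "\<dots> = 2 * of_nat (Suc n) * hermite m (Suc (Suc n)) * hermite (Suc m) n"
    by (simp only: hermite_def u_def[symmetric] v_def[symmetric] of_nat_poly numeral_poly) (simp add: mult_ac)
  finally show ?thesis .
qed

lemma hermite_0_left: "hermite 0 n = 1"
proof (induction n rule: less_induct)
  case (less n)
  consider "n = 0" | "n = 1" | k where "n = Suc (Suc k)"
    by (metis One_nat_def not0_implies_Suc)
  then show ?case
  proof cases
    case 3
    have "2 * of_nat (Suc k) * hermite 0 n = 2 * of_nat (Suc k) * 1"
      using hermite_rec_right[of k 0] less.IH[of "Suc k"] less.IH[of k] 3 by simp
    then show ?thesis
      by (simp only: mult_cancel_left) (simp del: of_nat_Suc)
  qed (simp_all add: hermite_0_right hermite_1)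
qed

section \<open>Degrees\<close>

lemma degree_gauss_poly:
  "degree (gauss_poly m) = m \<and> lead_coeff (gauss_poly m) = (-2) ^ m"
proof (induction m)
  case 0
  show ?case by simp
next
  case (Suc m)
  have nz: "gauss_poly m \<noteq> 0" using Suc by auto
  have X: "[:0, -2:] * gauss_poly m = pCons 0 (smult (-2) (gauss_poly m))"
    by simp
  have deg: "degree ([:0, -2:] * gauss_poly m) = Suc m"
    unfolding X using Suc nz by (simp add: degree_pCons_eq)
  have lower: "degree (pderiv (gauss_poly m)) < degree ([:0, -2:] * gauss_poly m)"
    unfolding deg using Suc by (simp add: degree_pderiv)
  have lead: "lead_coeff ([:0, -2:] * gauss_poly m) = (-2) ^ Suc m"
    using Suc.IH[THEN conjunct2] by (simp only: lead_coeff_mult) simp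
  show ?case
    unfolding gauss_poly_rec
    using trans[OF degree_add_eq_right[OF lower] deg] trans[OF lead_coeff_add_le[OF lower] lead]
    by (rule conjI)
qed

text \<open>
  In the recurrence for n the two derivative terms have smaller degree than the square of the middle
  polynomial, so degree and leading coefficient satisfy the recurrence of m n and of 2^(m n).
\<close>

lemma degree_and_lead_coeff_hermite:
  "degree (hermite m n) = m * n \<and> lead_coeff (hermite m n) = 2 ^ (m * n)"
proof (induction n rule: less_induct)
  case (less n)
  consider "n = 0" | "n = 1" | k where "n = Suc (Suc k)"
    by (metis One_nat_def not0_implies_Suc)
  then show ?case
  proof cases
    case 1
    then show ?thesis by (simp add: hermite_0_right)
  next
    case 2
    have "lead_coeff (hermite m n) = (-1) ^ m * (-2) ^ m"
      using 2 degree_gauss_poly[of m, THEN conjunct2] by (simp add: hermite_1)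
    also have "\<dots> = 2 ^ (m * n)"
      using 2 by (simp flip: power_mult_distrib)
    finally show ?thesis
      using 2 degree_gauss_poly[of m, THEN conjunct1] by (simp add: hermite_1)
  next
    case 3
    let ?f = "hermite m (Suc k)"
    let ?low = "- (?f * pderiv (pderiv ?f)) + (pderiv ?f)\<^sup>2"
    let ?top = "[:2 * real (Suc k):] * ?f\<^sup>2"
    have f: "degree ?f = m * Suc k" "lead_coeff ?f = 2 ^ (m * Suc k)" "?f \<noteq> 0"
      using less.IH[of "Suc k"] 3 by auto
    have b: "degree (hermite m k) = m * k" "lead_coeff (hermite m k) = 2 ^ (m * k)" "hermite m k \<noteq> 0"
      using less.IH[of k] 3 by auto
    have rec: "[:2 * real (Suc k):] * (hermite m n * hermite m k) = ?low + ?top"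
    proof -
      have "[:2 * real (Suc k):] = 2 * of_nat (Suc k)"
        by (simp add: of_nat_poly numeral_poly)
      then show ?thesis
        using hermite_rec_right[of k m] 3 by (simp only: mult.assoc)
    qed
    have top: "degree ?top = 2 * (m * Suc k)" "lead_coeff ?top = 2 * real (Suc k) * (2 ^ (m * Suc k))\<^sup>2"
    proof -
      show "degree ?top = 2 * (m * Suc k)"
        using f by (simp add: degree_power_eq)
      show "lead_coeff ?top = 2 * real (Suc k) * (2 ^ (m * Suc k))\<^sup>2"
        by (simp only: lead_coeff_mult lead_coeff_power f(2)) simp
    qed
    have sum: "degree (?low + ?top) = 2 * (m * Suc k)
        \<and> lead_coeff (?low + ?top) = 2 * real (Suc k) * (2 ^ (m * Suc k))\<^sup>2"
    proof (cases "m * Suc k = 0")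
      case True
      then have "pderiv ?f = 0"
        using f(1) by (metis pderiv_eq_0_iff)
      then show ?thesis using top by simp
    next
      case False
      have "degree (?f * pderiv (pderiv ?f)) \<le> m * Suc k + (m * Suc k - 1 - 1)"
        using degree_mult_le[of ?f "pderiv (pderiv ?f)"] f(1) by (simp add: degree_pderiv)
      moreover have "degree ((pderiv ?f)\<^sup>2) \<le> 2 * (m * Suc k - 1)"
        using degree_power_le[of "pderiv ?f" 2] f(1) by (simp add: degree_pderiv)
      ultimately have "degree ?low < degree ?top"
        unfolding top(1) using False by (intro degree_add_less) auto
      from trans[OF degree_add_eq_right[OF this] top(1)] trans[OF lead_coeff_add_le[OF this] top(2)]
      show ?thesis by (rule conjI)
    qed
    define q where "q = [:2 * real (Suc k):] * (hermite m n * hermite m k)"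
    have q: "degree q = 2 * (m * Suc k)" "lead_coeff q = 2 * real (Suc k) * (2 ^ (m * Suc k))\<^sup>2"
      using sum unfolding q_def rec by (rule conjunct1, rule conjunct2)
    have nz: "hermite m n \<noteq> 0"
    proof
      assume "hermite m n = 0"
      then have "lead_coeff q = 0" by (simp add: q_def)
      then show False unfolding q(2) by simp
    qed
    have "degree q = degree (hermite m n) + m * k"
      using b nz by (simp add: q_def degree_mult_eq)
    then have deg: "degree (hermite m n) = m * n"
      using q(1) 3 by (simp add: algebra_simps)
    have "2 * real (Suc k) * (lead_coeff (hermite m n) * 2 ^ (m * k)) = lead_coeff q"
      by (simp only: q_def lead_coeff_mult b(2)) simp
    also note q(2)
    finally have "2 * real (Suc k) * (lead_coeff (hermite m n) * 2 ^ (m * k))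
        = 2 * real (Suc k) * (2 ^ (m * Suc k))\<^sup>2" .
    then have "lead_coeff (hermite m n) * 2 ^ (m * k) = (2 ^ (m * Suc k))\<^sup>2"
      by (simp del: of_nat_Suc)
    also have "\<dots> = 2 ^ (m * n) * 2 ^ (m * k)"
      using 3 by (simp add: algebra_simps power2_eq_square flip: power_add)
    finally show ?thesis using deg by simp
  qed
qed

lemma hermite_nonzero: "hermite m n \<noteq> 0"
  using degree_and_lead_coeff_hermite[of m n] by auto

section \<open>Real zeros\<close>

text \<open>
  By induction on n in steps of two and on m: the positivity identity writes the product of the
  polynomial in question with a positive one as a square plus a positive term.
\<close>

lemma hermite_even_positive:
  assumes "even n"
  shows "0 < poly (hermite m n) x"
  using assms
proof (induction n arbitrary: m rule: less_induct)
  case (less n)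
  show ?case
  proof (cases "n = 0")
    case True
    then show ?thesis by (simp add: hermite_0_right)
  next
    case False
    then obtain k where n: "n = Suc (Suc k)" and k: "even k"
      using less.prems by (metis even_Suc not0_implies_Suc odd_Suc_minus_one)
    have pos_k: "0 < poly (hermite m k) x" for m
      using less.IH[of k] k n by simp
    show ?thesis
    proof (induction m)
      case 0
      show ?case by (simp add: hermite_0_left)
    next
      case (Suc m)
      have "poly (hermite (Suc m) n) x * poly (hermite (Suc m) k) x
          = (poly (hermite (Suc m) (Suc k)) x)\<^sup>2
            + 2 * real (Suc m) * poly (hermite m n) x * poly (hermite (Suc (Suc m)) k) x"
        using arg_cong[OF hermite_positivity_identity[of m k], of "\<lambda>p. poly p x"]
        by (simp add: n)
      also have "\<dots> > 0"
        using Suc pos_k[of "Suc (Suc m)"] by (intro add_nonneg_pos) auto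
      finally show ?case
        using pos_k[of "Suc m"] by (simp add: zero_less_mult_iff)
    qed
  qed
qed

text \<open>
  For odd n both neighbours n - 1 and n + 1 are even, so the product of neighbours that equals this
  Wronskian is positive.
\<close>

lemma hermite_odd_wronskian_positive:
  assumes "odd n"
  shows "0 < poly (hermite m n * pderiv (hermite (Suc m) n) - pderiv (hermite m n) * hermite (Suc m) n) x"
proof -
  obtain k where n: "n = Suc k" and "even k"
    using assms by (cases n) auto
  then show ?thesis
    using hermite_even_positive[of "Suc (Suc k)" m x] hermite_even_positive[of k "Suc m" x]
    by (simp only: n hermite_wronskian_pair) simp
qed

text \<open>
  Sending each element of A to the least element of B above it is a bijection onto B without its
  minimum.
\<close>

lemma card_interlacing:
  fixes A B :: "'a::linorder set"
  assumes fin: "finite A" "finite B" and "B \<noteq> {}"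
    and above: "\<And>a. a \<in> A \<Longrightarrow> \<exists>b\<in>B. a < b"
    and below: "\<And>a. a \<in> A \<Longrightarrow> \<exists>b\<in>B. b < a"
    and between_A: "\<And>a a'. a \<in> A \<Longrightarrow> a' \<in> A \<Longrightarrow> a < a' \<Longrightarrow> \<exists>b\<in>B. a < b \<and> b < a'"
    and between_B: "\<And>b b'. b \<in> B \<Longrightarrow> b' \<in> B \<Longrightarrow> b < b' \<Longrightarrow> \<exists>a\<in>A. b < a \<and> a < b'"
  shows "card B = Suc (card A)"
proof -
  define next_B where "next_B a = Min {b \<in> B. a < b}" for a
  have next_B: "next_B a \<in> B" "a < next_B a" and next_B_le: "\<And>b. b \<in> B \<Longrightarrow> a < b \<Longrightarrow> next_B a \<le> b"
    if "a \<in> A" for a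
  proof -
    have "finite {b \<in> B. a < b}" "{b \<in> B. a < b} \<noteq> {}"
      using fin above[OF that] by auto
    from Min_in[OF this] Min_le[OF this(1)]
    show "next_B a \<in> B" "a < next_B a" "\<And>b. b \<in> B \<Longrightarrow> a < b \<Longrightarrow> next_B a \<le> b"
      unfolding next_B_def by auto
  qed
  have Min_B: "Min B \<in> B" "\<And>b. b \<in> B \<Longrightarrow> Min B \<le> b"
    using fin \<open>B \<noteq> {}\<close> by auto
  have less_image: "next_B a < next_B a'" if "a \<in> A" "a' \<in> A" "a < a'" for a a'
    using between_A[OF that] next_B_le[OF that(1)] next_B(2)[OF that(2)]
    by (meson le_less_trans less_trans)
  have "inj_on next_B A"
    by (rule inj_onI) (metis less_image less_irrefl linorder_neqE)
  moreover have "next_B ` A = B - {Min B}"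
  proof (intro equalityI subsetI)
    fix b assume "b \<in> next_B ` A"
    then obtain a where a: "a \<in> A" "b = next_B a" by blast
    obtain b' where "b' \<in> B" "b' < a" using below[OF a(1)] by blast
    then have "Min B < b" using Min_B(2)[of b'] next_B(2)[OF a(1)] a(2) by simp
    then show "b \<in> B - {Min B}" using next_B(1)[OF a(1)] a(2) by auto
  next
    fix b assume b: "b \<in> B - {Min B}"
    then have "Min B < b" using Min_B(2)[of b] by auto
    then obtain a0 where a0: "a0 \<in> A" "a0 < b"
      using between_B[OF Min_B(1)] b by blast
    define a where "a = Max {a \<in> A. a < b}"
    have "finite {a \<in> A. a < b}" "{a \<in> A. a < b} \<noteq> {}" using fin a0 by auto
    from Max_in[OF this] Max_ge[OF this(1)]
    have a: "a \<in> A" "a < b" and a_max: "\<And>a'. a' \<in> A \<Longrightarrow> a' < b \<Longrightarrow> a' \<le> a"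
      unfolding a_def by auto
    have "\<not> next_B a < b"
    proof
      assume "next_B a < b"
      then obtain a' where "a' \<in> A" "next_B a < a'" "a' < b"
        using between_B next_B(1)[OF a(1)] b by blast
      then show False using a_max[of a'] next_B(2)[OF a(1)] by simp
    qed
    then have "next_B a = b"
      using next_B_le[OF a(1)] a(2) b by (meson DiffD1 leI order_antisym)
    then show "b \<in> next_B ` A" using a(1) by blast
  qed
  ultimately have "card A = card (B - {Min B})"
    using card_image by fastforce
  then show ?thesis
    using card_Suc_Diff1[OF fin(2) Min_B(1)] by simp
qed

text \<open>
  Without a zero of f, the quotient g/f would be defined on the whole interval, vanish at both ends and
  have the nonvanishing derivative W/f^2, against Rolle's theorem.
\<close>

lemma root_between_roots:
  fixes f g :: "real poly"
  assumes W: "\<And>x. poly (f * pderiv g - pderiv f * g) x \<noteq> 0"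
    and u: "poly g u = 0" and v: "poly g v = 0" and uv: "u < v"
  shows "\<exists>z. u < z \<and> z < v \<and> poly f z = 0"
proof (rule ccontr)
  assume no_root: "\<not> ?thesis"
  have ends: "poly f u \<noteq> 0" "poly f v \<noteq> 0"
    using W[of u] W[of v] u v by auto
  have nz: "poly f x \<noteq> 0" if "u \<le> x" "x \<le> v" for x
    using no_root ends that by (metis order_le_less)
  let ?q = "\<lambda>x. poly g x / poly f x"
  have deriv: "(?q has_real_derivative
      (poly (f * pderiv g - pderiv f * g) x) / (poly f x * poly f x)) (at x)" if "u \<le> x" "x \<le> v" for x
    by (rule derivative_eq_intros poly_DERIV refl nz that | simp add: algebra_simps)+
  have "\<exists>l z. u < z \<and> z < v \<and> DERIV ?q z :> l \<and> ?q v - ?q u = (v - u) * l"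
  proof (rule MVT[OF uv])
    show "continuous_on {u..v} ?q"
      using nz by (intro continuous_intros) auto
    show "?q differentiable (at x)" if "u < x" "x < v" for x
      using deriv[of x] that by (auto simp: real_differentiable_def)
  qed
  then obtain l z where z: "u < z" "z < v" "DERIV ?q z :> l" "?q v - ?q u = (v - u) * l"
    by blast
  have "l = (poly (f * pderiv g - pderiv f * g) z) / (poly f z * poly f z)"
    using DERIV_unique[OF z(3)] deriv[of z] z by simp
  moreover have "l = 0" using z(4) u v uv by simp
  ultimately show False using W[of z] nz[of z] z by simp
qed

lemma eventually_positive_above:
  fixes p :: "real poly"
  assumes "0 < lead_coeff p"
  shows "\<exists>y>x. 0 < poly p y"
proof -
  obtain N where "\<forall>y\<ge>N. lead_coeff p \<le> poly p y"
    using poly_pinfty_gt_lc[OF assms] by blast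
  then have "x < max (x + 1) N" "lead_coeff p \<le> poly p (max (x + 1) N)" by auto
  then show ?thesis using assms by (meson less_le_trans)
qed

text \<open>
  At the largest zero a of f, positivity of the Wronskian reads f'(a) g(a) < 0. As f is positive beyond
  a, f'(a) cannot be negative, so g(a) < 0, while g is positive near infinity.
\<close>

lemma root_above:
  fixes f g :: "real poly"
  assumes W: "\<And>x. 0 < poly (f * pderiv g - pderiv f * g) x"
    and lead: "0 < lead_coeff f" "0 < lead_coeff g" and z: "poly f z = 0"
  shows "\<exists>y>z. poly g y = 0"
proof -
  have "f \<noteq> 0" using lead by auto
  define a where "a = Max {x. poly f x = 0}"
  have fin: "finite {x. poly f x = 0}" and ne: "{x. poly f x = 0} \<noteq> {}"
    using poly_roots_finite[OF \<open>f \<noteq> 0\<close>] z by auto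
  have a: "poly f a = 0" and a_max: "\<And>x. poly f x = 0 \<Longrightarrow> x \<le> a"
    using Max_in[OF fin ne] Max_ge[OF fin] unfolding a_def by auto
  have pos: "0 < poly f x" if "a < x" for x
  proof (rule ccontr)
    assume neg: "\<not> 0 < poly f x"
    have "poly f x \<noteq> 0" using a_max[of x] that by auto
    moreover obtain y where "x < y" "0 < poly f y"
      using eventually_positive_above[OF lead(1)] by blast
    ultimately obtain w where "x < w" "poly f w = 0"
      using poly_IVT_pos[of x y f] neg by auto
    then show False using a_max[of w] that by simp
  qed
  have "poly (pderiv f) a * poly g a < 0"
    using W[of a] a by simp
  moreover have "0 \<le> poly (pderiv f) a"
  proof (rule ccontr)
    assume "\<not> ?thesis"
    then obtain d where "0 < d" "\<And>h. 0 < h \<Longrightarrow> h < d \<Longrightarrow> poly f (a + h) < poly f a"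
      using DERIV_neg_dec_right[OF poly_DERIV[of f a]] by auto
    from this(2)[of "d / 2"] this(1) have "poly f (a + d / 2) < 0" using a by simp
    then show False using pos[of "a + d / 2"] \<open>0 < d\<close> by simp
  qed
  ultimately have "poly g a < 0"
    by (simp add: mult_less_0_iff)
  moreover obtain y where "a < y" "0 < poly g y"
    using eventually_positive_above[OF lead(2)] by blast
  ultimately obtain w where "a < w" "poly g w = 0"
    using poly_IVT_pos[of a y g] by auto
  then show ?thesis using a_max[OF z] by (intro exI[of _ w]) auto
qed

text \<open>
  Reflection at the origin reverses the sign of the Wronskian; the signs that make the leading
  coefficients positive again restore it exactly when the degrees have different parity.
\<close>

lemma poly_reflect_wronskian:
  fixes f g :: "real poly"
  shows "poly (pcompose f [:0, -1:] * pderiv (pcompose g [:0, -1:])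
      - pderiv (pcompose f [:0, -1:]) * pcompose g [:0, -1:]) x
    = - poly (f * pderiv g - pderiv f * g) (- x)"
  by (simp add: pderiv_pcompose pderiv_pCons poly_pcompose algebra_simps)

lemma lead_coeff_reflect:
  fixes f :: "real poly"
  shows "lead_coeff (pcompose f [:0, -1:]) = (-1) ^ degree f * lead_coeff f"
  by (subst lead_coeff_comp) auto

lemma root_below:
  fixes f g :: "real poly"
  assumes W: "\<And>x. 0 < poly (f * pderiv g - pderiv f * g) x"
    and lead: "0 < lead_coeff f" "0 < lead_coeff g"
    and parity: "odd (degree f + degree g)" and z: "poly f z = 0"
  shows "\<exists>y<z. poly g y = 0"
proof -
  let ?F = "smult ((-1) ^ degree f) (pcompose f [:0, -1:])"
  let ?G = "smult ((-1) ^ degree g) (pcompose g [:0, -1:])"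
  have sign: "((-1) ^ degree f * (-1) ^ degree g :: real) = -1"
    using parity by (simp flip: power_add)
  have "\<exists>y>-z. poly ?G y = 0"
  proof (rule root_above[of ?F ?G "-z"])
    have sq: "(-1 :: real) ^ k * (-1) ^ k = 1" for k
      by (simp flip: power_add)
    have "lead_coeff ?F = lead_coeff f" "lead_coeff ?G = lead_coeff g"
      by (simp_all only: lead_coeff_smult lead_coeff_reflect mult.assoc[symmetric] sq mult_1)
    then show "0 < lead_coeff ?F" "0 < lead_coeff ?G"
      using lead by simp_all
    show "poly ?F (- z) = 0"
      using z by (simp add: poly_pcompose)
    show "0 < poly (?F * pderiv ?G - pderiv ?F * ?G) x" for x
    proof -
      have "?F * pderiv ?G - pderiv ?F * ?G = smult ((-1) ^ degree f * (-1) ^ degree g)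
          (pcompose f [:0, -1:] * pderiv (pcompose g [:0, -1:])
            - pderiv (pcompose f [:0, -1:]) * pcompose g [:0, -1:])"
        by (simp add: pderiv_smult smult_diff_right mult.commute)
      then show ?thesis
        using W[of "- x"] by (simp only: sign poly_smult poly_reflect_wronskian)
    qed
  qed
  then obtain y where "y > - z" "poly g (- y) = 0"
    by (auto simp: poly_pcompose)
  then show ?thesis by (intro exI[of _ "- y"]) auto
qed

lemma card_roots_step:
  fixes f g :: "real poly"
  assumes W: "\<And>x. 0 < poly (f * pderiv g - pderiv f * g) x"
    and lead: "0 < lead_coeff f" "0 < lead_coeff g"
    and parity: "odd (degree f + degree g)"
    and root: "\<exists>x. poly g x = 0"
  shows "card {x. poly g x = 0} = Suc (card {x. poly f x = 0})"
proof (rule card_interlacing)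
  have "f \<noteq> 0" "g \<noteq> 0" using lead by auto
  then show "finite {x. poly f x = 0}" "finite {x. poly g x = 0}"
    by (simp_all add: poly_roots_finite)
  show "{x. poly g x = 0} \<noteq> {}" using root by auto
  show "\<exists>b\<in>{x. poly g x = 0}. a < b" if "a \<in> {x. poly f x = 0}" for a
    using root_above[OF W lead] that by auto
  show "\<exists>b\<in>{x. poly g x = 0}. b < a" if "a \<in> {x. poly f x = 0}" for a
    using root_below[OF W lead parity] that by auto
  show "\<exists>a\<in>{x. poly f x = 0}. b < a \<and> a < b'"
    if "b \<in> {x. poly g x = 0}" "b' \<in> {x. poly g x = 0}" "b < b'" for b b'
  proof -
    have "poly (f * pderiv g - pderiv f * g) x \<noteq> 0" for x
      using W[of x] by simp
    from root_between_roots[OF this] that show ?thesis by auto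
  qed
  show "\<exists>b\<in>{x. poly g x = 0}. a < b \<and> b < a'"
    if "a \<in> {x. poly f x = 0}" "a' \<in> {x. poly f x = 0}" "a < a'" for a a'
  proof -
    have "poly (g * pderiv f - pderiv g * f) x \<noteq> 0" for x
      using W[of x] by (simp add: algebra_simps)
    from root_between_roots[OF this] that show ?thesis by auto
  qed
qed

lemma odd_degree_root:
  fixes g :: "real poly"
  assumes lead: "0 < lead_coeff g" and odd: "odd (degree g)"
  shows "\<exists>x. poly g x = 0"
proof -
  obtain y where y: "0 < y" "0 < poly g y"
    using eventually_positive_above[OF lead] by blast
  have "0 < lead_coeff (- pcompose g [:0, -1:])"
    using lead odd by (simp only: lead_coeff_minus lead_coeff_reflect) simp
  then obtain x where x: "0 < x" "0 < poly (- pcompose g [:0, -1:]) x"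
    using eventually_positive_above by blast
  have "poly g (- x) < 0" using x(2) by (simp add: poly_pcompose)
  then show ?thesis
    using poly_IVT_pos[of "- x" y g] x y by auto
qed

text \<open>
  The zeros for m and for m + 1 interlace strictly, with zeros for m + 1 at both ends. One of the two
  degrees m n and (m + 1) n is odd, which provides a first zero.
\<close>

lemma card_real_roots_hermite_odd:
  assumes "odd n"
  shows "card {x. poly (hermite m n) x = 0} = m"
proof (induction m)
  case 0
  show ?case by (simp add: hermite_0_left)
next
  case (Suc m)
  let ?f = "hermite m n" and ?g = "hermite (Suc m) n"
  have lead: "0 < lead_coeff ?f" "0 < lead_coeff ?g"
    by (simp_all only: degree_and_lead_coeff_hermite[THEN conjunct2]) simp_all
  have deg: "degree ?f = m * n" "degree ?g = Suc m * n"
    using degree_and_lead_coeff_hermite by blast+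
  have parity: "odd (degree ?f + degree ?g)"
    using assms by (simp add: deg)
  have W: "0 < poly (?f * pderiv ?g - pderiv ?f * ?g) x" for x
    by (rule hermite_odd_wronskian_positive[OF assms])
  have root: "\<exists>x. poly ?g x = 0"
  proof (cases "even m")
    case True
    then show ?thesis
      using odd_degree_root[OF lead(2)] assms by (simp add: deg)
  next
    case False
    then obtain z where "poly ?f z = 0"
      using odd_degree_root[OF lead(1)] assms by (auto simp: deg)
    then show ?thesis
      using root_above[OF W lead] by blast
  qed
  show ?case
    using card_roots_step[OF W lead parity root] Suc.IH by simp
qed

section \<open>Identification with the recursively defined family\<close>

definition real_to_rational_function :: "real poly \<Rightarrow> complex poly fract" where
  "real_to_rational_function p = to_fract (map_poly of_real p)"

interpretation complexify: map_poly_inj_idom_hom "of_real :: real \<Rightarrow> complex" ..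

lemma real_to_rational_function_hom:
  "real_to_rational_function 1 = 1"
  "real_to_rational_function (p + q) = real_to_rational_function p + real_to_rational_function q"
  "real_to_rational_function (p - q) = real_to_rational_function p - real_to_rational_function q"
  "real_to_rational_function (- p) = - real_to_rational_function p"
  "real_to_rational_function (p * q) = real_to_rational_function p * real_to_rational_function q"
  "real_to_rational_function (p\<^sup>2) = (real_to_rational_function p)\<^sup>2"
  "real_to_rational_function (pderiv p) = fract_deriv (real_to_rational_function p)"
  "real_to_rational_function p = 0 \<longleftrightarrow> p = 0"
  unfolding real_to_rational_function_def power2_eq_square
  by (simp_all add: complexify.hom_add complexify.hom_minus complexify.hom_uminus complexify.hom_mult
      fract_deriv_to_fract of_real_hom.map_poly_pderiv)

lemma real_to_rational_function_of_nat:
  "real_to_rational_function (of_nat k) = of_nat k"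
proof (induction k)
  case 0
  show ?case by (simp add: real_to_rational_function_hom(8))
qed (simp add: real_to_rational_function_hom)

lemma real_to_rational_function_2: "real_to_rational_function 2 = 2"
  using real_to_rational_function_of_nat[of 2] by simp

lemma gen_hermite_family_hermite:
  "gen_hermite_family (\<lambda>m n. real_to_rational_function (hermite m n))"
proof -
  let ?E = real_to_rational_function
  have "2 * of_nat m * ?E (hermite (m + 1) n) * ?E (hermite (m - 1) n)
      = ?E (hermite m n) * fract_deriv (fract_deriv (?E (hermite m n)))
        - (fract_deriv (?E (hermite m n)))\<^sup>2 + 2 * of_nat m * (?E (hermite m n))\<^sup>2" if pos: "m \<ge> 1" for m n
  proof -
    obtain l where m: "m = Suc l" using pos by (cases m) auto
    show ?thesis
      using arg_cong[OF hermite_rec_left[of l n], of ?E]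
      by (simp only: real_to_rational_function_hom real_to_rational_function_of_nat real_to_rational_function_2 m Suc_eq_plus1[symmetric] diff_Suc_1)
  qed
  moreover have "2 * of_nat n * ?E (hermite m (n + 1)) * ?E (hermite m (n - 1))
      = - (?E (hermite m n) * fract_deriv (fract_deriv (?E (hermite m n))))
        + (fract_deriv (?E (hermite m n)))\<^sup>2 + 2 * of_nat n * (?E (hermite m n))\<^sup>2" if pos: "n \<ge> 1" for m n
  proof -
    obtain l where n: "n = Suc l" using pos by (cases n) auto
    show ?thesis
      using arg_cong[OF hermite_rec_right[of l m], of ?E]
      by (simp only: real_to_rational_function_hom real_to_rational_function_of_nat real_to_rational_function_2 n Suc_eq_plus1[symmetric] diff_Suc_1)
  qed
  moreover have "?E (hermite 1 1) = to_fract [:0, 2:]"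
  proof -
    have "hermite 1 1 = [:0, 2:]"
      by (simp add: hermite_1 gauss_poly_rec)
    then show ?thesis
      by (simp add: real_to_rational_function_def map_poly_pCons)
  qed
  ultimately show ?thesis
    unfolding gen_hermite_family_def
    by (simp add: hermite_0_left hermite_0_right real_to_rational_function_hom)
qed

text \<open>
  The recurrence for m determines the rows n = 0 and n = 1 from the initial values, and the recurrence
  for n then determines everything; the divisions are possible because the known family never
  vanishes.
\<close>

lemma gen_hermite_family_unique:
  assumes "gen_hermite_family H"
  shows "H m n = real_to_rational_function (hermite m n)"
proof -
  define F where "F m n = real_to_rational_function (hermite m n)" for m n
  have F: "gen_hermite_family F"
    using gen_hermite_family_hermite by (simp add: F_def[abs_def])
  have F_nonzero: "F m n \<noteq> 0" for m n
    by (simp add: F_def real_to_rational_function_hom hermite_nonzero)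
  have coeff_nonzero: "2 * of_nat (Suc k) \<noteq> (0 :: complex poly fract)" for k
    using real_to_rational_function_hom(8)[of "2 * of_nat (Suc k)"]
    by (simp add: real_to_rational_function_hom(5) real_to_rational_function_of_nat
        real_to_rational_function_2 del: of_nat_Suc)
  have left: "2 * of_nat (Suc k) * G (Suc (Suc k)) n * G k n
      = G (Suc k) n * fract_deriv (fract_deriv (G (Suc k) n)) - (fract_deriv (G (Suc k) n))\<^sup>2
        + 2 * of_nat (Suc k) * (G (Suc k) n)\<^sup>2" if "gen_hermite_family G" for G k n
    using that[unfolded gen_hermite_family_def, THEN conjunct1, rule_format, of "Suc k" n] by simp
  have right: "2 * of_nat (Suc k) * G m (Suc (Suc k)) * G m k
      = - (G m (Suc k) * fract_deriv (fract_deriv (G m (Suc k)))) + (fract_deriv (G m (Suc k)))\<^sup>2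
        + 2 * of_nat (Suc k) * (G m (Suc k))\<^sup>2" if "gen_hermite_family G" for G k m
    using that[unfolded gen_hermite_family_def, THEN conjunct2, THEN conjunct1, rule_format, of "Suc k" m] by simp
  have initial: "H a b = F a b" if "a \<le> 1" "b \<le> 1" for a b
  proof -
    have "(a, b) \<in> {(0, 0), (1, 0), (0, 1), (1, 1)}" using that by auto
    then show ?thesis
      using assms F unfolding gen_hermite_family_def by auto
  qed
  have rows: "H a b = F a b" if "b \<le> 1" for a b
  proof (induction a rule: less_induct)
    case (less a)
    show ?case
    proof (cases "a \<le> 1")
      case False
      then obtain k where a: "a = Suc (Suc k)"
        by (metis One_nat_def Suc_le_mono le0 not0_implies_Suc)
      have "2 * of_nat (Suc k) * H a b * F k b = 2 * of_nat (Suc k) * F a b * F k b"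
        using left[OF assms, of k b] left[OF F, of k b] less.IH[of k] less.IH[of "Suc k"] a by simp
      then show ?thesis
        using F_nonzero coeff_nonzero by simp
    qed (use initial that in simp)
  qed
  have "H m n = F m n"
  proof (induction n rule: less_induct)
    case (less n)
    show ?case
    proof (cases "n \<le> 1")
      case False
      then obtain k where n: "n = Suc (Suc k)"
        by (metis One_nat_def Suc_le_mono le0 not0_implies_Suc)
      have "2 * of_nat (Suc k) * H m n * F m k = 2 * of_nat (Suc k) * F m n * F m k"
        using right[OF assms, of k m] right[OF F, of k m] less.IH[of k] less.IH[of "Suc k"] n by simp
      then show ?thesis
        using F_nonzero coeff_nonzero by simp
    qed (use rows in simp)
  qed
  then show ?thesis by (simp add: F_def)
qed

lemma gen_hermite_eq_hermite: "gen_hermite m n = real_to_rational_function (hermite m n)"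
proof -
  have "gen_hermite = (\<lambda>m n. real_to_rational_function (hermite m n))"
    unfolding gen_hermite_def
    by (rule the_equality) (use gen_hermite_family_hermite gen_hermite_family_unique in \<open>blast\<close>)+
  then show ?thesis by (rule fun_cong[THEN fun_cong])
qed

theorem corollary3p5:
  fixes m n :: nat
  shows "\<exists>p :: complex poly.
           gen_hermite m n = to_fract p \<and> p \<noteq> 0 \<and> degree p = m * n \<and>
           (odd n \<longrightarrow> card {z \<in> \<real>. poly p z = 0} = m) \<and>
           (even n \<longrightarrow> {z \<in> \<real>. poly p z = 0} = {})"
proof -
  let ?p = "map_poly complex_of_real (hermite m n)"
  have roots: "{z \<in> \<real>. poly ?p z = 0} = complex_of_real ` {x. poly (hermite m n) x = 0}"
    by (auto simp: Reals_def)
  have "gen_hermite m n = to_fract ?p"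
    by (simp add: gen_hermite_eq_hermite real_to_rational_function_def)
  moreover have "?p \<noteq> 0" "degree ?p = m * n"
    using hermite_nonzero degree_and_lead_coeff_hermite[of m n] by simp_all
  moreover have "card {z \<in> \<real>. poly ?p z = 0} = m" if "odd n"
    unfolding roots using card_real_roots_hermite_odd[OF that]
    by (simp add: card_image inj_on_def)
  moreover have "{z \<in> \<real>. poly ?p z = 0} = {}" if "even n"
    unfolding roots using hermite_even_positive[OF that] by (force simp: less_le)
  ultimately show ?thesis by blast
qed

end
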